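(* Let $k\ge 1$, let $A\in GL_k(\mathbf{Q})\cap M_k(\mathbf{Z})$ have eigenvalues $\lambda_1,\dots,\lambda_k\in\mathbf{C}^{*}$ (with multiplicity) such that $|\lambda_i|\neq 1$ for $i=1,\dots,k$. Let $\mu$ be a probability distribution on $\mathbf{Z}^k$ whose support is not parallel to a proper subspace of $\mathbf{Q}^k$ invariant under $A$, let $\{\mathbf{B}_n\}_{n\ge 0}$ be independent random vectors in $\mathbf{Z}^k$ with common law $\mu$, and let $\mathbf{x}_0\in\mathbf{Z}^k$. For each modulus $p$ let $\mathbf{X}_{n+1}=A\mathbf{X}_n+\mathbf{B}_n$ (mod $p$), $\mathbf{X}_0=\mathbf{x}_0$, and let $P_n$ be the law of $\mathbf{X}_n$ on $\mathbf{Z}_p^k$. Let $B=(\mathbf{y}_1\,\dots\,\mathbf{y}_k)$ be a matrix whose columns form a basis of $\mathbf{Q}^k$ contained in $V^{d-1}$. Then there exist $c\in\mathbf{R}^{+}$ and a function $\varepsilon$ with $\lim_{p\to\infty}\varepsilon(p)=0$ such that, for all positive integers $p$ with $\gcd(\det(A),p)=\gcd(\det(B),p)=1$ and all integers $n\ge c(\ln p)^2$, $$\|P_n-U\|\le \varepsilon(p).$$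
   Context: $\mathbf{Z}_p^k=(\mathbf{Z}/p\mathbf{Z})^k$; $U$ is the uniform distribution on $\mathbf{Z}_p^k$; $\|P_n-U\|=\frac12\sum_{\mathbf{x}\in\mathbf{Z}_p^k}|P_n(\mathbf{x})-U(\mathbf{x})|$ is the variation distance. $d\le k$ is the degree of the minimum polynomial of $A$. The support of $\mu$ is parallel to a subspace $W\subset\mathbf{Q}^k$ if it is contained in some translate $\mathbf{v}+W$; "proper" means $W\neq\mathbf{Q}^k$ (so $W=\{\mathbf 0\}$ is allowed). Set $V=\{\mathbf{h}-\mathbf{k}:\mathbf{h},\mathbf{k}\in\operatorname{supp}\mu\}$ and $V^{d-1}=\{A^m\mathbf{x}:\mathbf{x}\in V,\ m=0,1,\dots,d-1\}$. Under the hypothesis on the support of $\mu$, $V^{d-1}$ contains a basis of $\mathbf{Q}^k$; one such basis $\{\mathbf{y}_1,\dots,\mathbf{y}_k\}$ is fixed and $B$ is the integer matrix with these columns. The matrix $A$, the law $\mu$ and the vector $\mathbf{x}_0$ do not depend on $p$. *)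

theory Defs
  imports "HOL-Probability.Probability" "HOL-Computational_Algebra.Polynomial"
begin

abbreviation rat_vec :: "int ^ 'n \<Rightarrow> rat ^ 'n" where
  "rat_vec x \<equiv> (\<chi> i. rat_of_int (x $ i))"

abbreviation rat_matrix :: "int ^ 'n ^ 'm \<Rightarrow> rat ^ 'n ^ 'm" where
  "rat_matrix A \<equiv> map_matrix rat_of_int A"

primrec matrix_power :: "'a::semiring_1 ^ 'n ^ 'n \<Rightarrow> nat \<Rightarrow> 'a ^ 'n ^ 'n" where
  "matrix_power A 0 = mat 1"
| "matrix_power A (Suc m) = A ** matrix_power A m"

text \<open>\<open>mat c\<close> is the scalar matrix \<open>c I\<close>.\<close>

definition poly_matrix :: "'a::comm_ring_1 poly \<Rightarrow> 'a ^ 'n ^ 'n \<Rightarrow> 'a ^ 'n ^ 'n" where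
  "poly_matrix q A = (\<Sum>i\<le>degree q. mat (coeff q i) ** matrix_power A i)"

definition minimum_poly :: "'a::field ^ 'n ^ 'n \<Rightarrow> 'a poly" where
  "minimum_poly A = (THE q. lead_coeff q = 1 \<and> poly_matrix q A = 0 \<and>
     (\<forall>r. r \<noteq> 0 \<and> poly_matrix r A = 0 \<longrightarrow> degree q \<le> degree r))"

definition eigenvalue :: "'a::field ^ 'n ^ 'n \<Rightarrow> 'a \<Rightarrow> bool" where
  "eigenvalue A l \<longleftrightarrow> (\<exists>v. v \<noteq> 0 \<and> A *v v = l *s v)"

definition invariant_under :: "'a::semiring_1 ^ 'n ^ 'n \<Rightarrow> ('a ^ 'n) set \<Rightarrow> bool" where
  "invariant_under A W \<longleftrightarrow> (\<forall>w\<in>W. A *v w \<in> W)"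

definition parallel_to :: "(int ^ 'n) set \<Rightarrow> (rat ^ 'n) set \<Rightarrow> bool" where
  "parallel_to S W \<longleftrightarrow> (\<exists>v. rat_vec ` S \<subseteq> (\<lambda>w. v + w) ` W)"

definition is_column_basis :: "int ^ 'n ^ 'n \<Rightarrow> bool" where
  "is_column_basis B \<longleftrightarrow>
     vec.independent (columns (rat_matrix B)) \<and> vec.span (columns (rat_matrix B)) = UNIV"

text \<open>For \<open>S\<close> the support of the increments, \<open>diff_orbit A S\<close> is the set \<open>V\<^sup>d\<^sup>-\<^sup>1\<close>:
  all \<open>A\<^sup>m x\<close> with \<open>x\<close> a difference of two elements of \<open>S\<close> and \<open>0 \<le> m \<le> d - 1\<close>,
  where \<open>d\<close> is the degree of the minimum polynomial of \<open>A\<close> over the rationals.\<close>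

definition diff_orbit :: "int ^ 'n ^ 'n \<Rightarrow> (int ^ 'n) set \<Rightarrow> (int ^ 'n) set" where
  "diff_orbit A S = {matrix_power A m *v (h - k) | m h k.
     m < degree (minimum_poly (rat_matrix A)) \<and> h \<in> S \<and> k \<in> S}"

text \<open>Elements of \<open>(\<int>/p\<int>)\<^sup>k\<close> are represented by the vectors with entries in \<open>{0..<p}\<close>;
  this is meant for \<open>p > 0\<close>.\<close>

definition Z_mod :: "nat \<Rightarrow> (int ^ 'n) set" where
  "Z_mod p = {x. \<forall>i. x $ i \<in> {0..<int p}}"

definition vec_mod :: "int ^ 'n \<Rightarrow> nat \<Rightarrow> int ^ 'n" where
  "vec_mod x p = (\<chi> i. x $ i mod int p)"

primrec walk :: "int ^ 'n ^ 'n \<Rightarrow> (nat \<Rightarrow> 'w \<Rightarrow> int ^ 'n) \<Rightarrow> int ^ 'n \<Rightarrow> nat \<Rightarrow> nat \<Rightarrow> 'w \<Rightarrow> int ^ 'n"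
where
  "walk A b x0 p 0 \<omega> = vec_mod x0 p"
| "walk A b x0 p (Suc n) \<omega> = vec_mod (A *v walk A b x0 p n \<omega> + b n \<omega>) p"

definition walk_law :: "'w measure \<Rightarrow> int ^ 'n ^ 'n \<Rightarrow> (nat \<Rightarrow> 'w \<Rightarrow> int ^ 'n) \<Rightarrow> int ^ 'n \<Rightarrow>
    nat \<Rightarrow> nat \<Rightarrow> (int ^ 'n) measure" where
  "walk_law M A b x0 p n = distr M (count_space (Z_mod p)) (walk A b x0 p n)"

definition variation_distance :: "'a set \<Rightarrow> 'a measure \<Rightarrow> 'a measure \<Rightarrow> real" where
  "variation_distance S P Q = 1/2 * (\<Sum>x\<in>S. \<bar>measure P {x} - measure Q {x}\<bar>)"

end

theory Submission
  imports Defs "HOL-Computational_Algebra.Fundamental_Theorem_Algebra"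
begin

text \<open>
  The proof is Fourier analysis on the group of residue vectors combined with the hyperbolicity of
  \<open>A\<close>. By Fourier inversion the variation distance is at most the sum, over the nonzero
  frequencies \<open>\<alpha>\<close>, of the absolute values of the Fourier coefficients of the law of the walk
  (\<open>variation_distance_uniform_le_sum_char\<close>). Independence of the increments turns such an absolute
  value into the product, over \<open>j < n\<close>, of the absolute values of the transform of \<open>\<mu>\<close> at the
  frequencies \<open>\<alpha> A\<^sup>j\<close> (\<open>norm_char_walk_law\<close>). There are fewer than \<open>p\<^sup>k\<close> frequencies, so it
  is enough that among any \<open>O(ln p)\<close> consecutive factors at least one is bounded by a constant
  less than 1: then \<open>n \<ge> c (ln p)\<^sup>2\<close> factors contribute a power of \<open>1/p\<close> with an exponent as
  large as desired (\<open>logarithmic_window_gap\<close>, \<open>exp_power_window_bound\<close>).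

  A factor can only be close to 1 if \<open>\<alpha> A\<^sup>j (h - k)\<close> is close to a multiple of \<open>p\<close>, relative to \<open>p\<close>,
  for all relevant \<open>h\<close>, \<open>k\<close> in the support of \<open>\<mu>\<close> (\<open>norm_char_pmf_le\<close>). If this persists over a
  window then all entries of \<open>\<alpha> A\<^sup>j B\<close> stay close to multiples of \<open>p\<close>. Let \<open>w\<^sub>j\<close> be the vector of the
  small representatives. Multiplying by the adjugate of \<open>B\<close>, rather than by the inverse, gives small
  integer vectors \<open>z\<^sub>j\<close> congruent to \<open>det B \<alpha> A\<^sup>j\<close>. Since \<open>z\<^sub>j\<^sub>+\<^sub>1 - z\<^sub>j A\<close> is divisible by
  \<open>p\<close> and smaller than \<open>p\<close>, it vanishes: the \<open>z\<^sub>j\<close> form a genuine orbit of \<open>A\<close> in the integer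
  lattice, all of whose points are bounded by \<open>p\<close>. As no eigenvalue lies on the unit circle, an
  orbit that is bounded on a long window is exponentially small in its middle: the contracted
  directions have decayed since the start of the window and the expanded ones still have to grow
  before its end. After a multiple of \<open>ln p\<close> steps the middle point is an integer vector of norm less
  than 1, hence zero (\<open>hyperbolic_integer_orbit_vanishes\<close>), and the coprimality of \<open>p\<close> to \<open>det A\<close>
  and \<open>det B\<close> then forces \<open>\<alpha>\<close> to vanish modulo \<open>p\<close> (\<open>dual_orbit_escapes\<close>).

  The decomposition into stable and unstable subspaces is avoided. Each coordinate of an orbit
  is a scalar sequence killed by a product of operators \<open>E - \<lambda>\<close>, with \<open>E\<close> the shift and \<open>\<lambda>\<close>
  eigenvalues of \<open>A\<close> (\<open>eigenvalues_annihilate_finite_set\<close>), and these first-order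
  operators are inverted one at a time (\<open>recurrence_window_contraction\<close>).
\<close>

section \<open>Recurrences with no characteristic root on the unit circle\<close>

text \<open>The operator \<open>E - l\<close> on sequences, where \<open>E\<close> is the shift. A recurrence with characteristic
  polynomial \<open>\<Prod>(X - l)\<close> is given by the list of its roots, so that it can be
  solved by induction on the list.\<close>

definition shift_diff :: "complex \<Rightarrow> (nat \<Rightarrow> complex) \<Rightarrow> nat \<Rightarrow> complex" where
  "shift_diff l x n = x (Suc n) - l * x n"

text \<open>\<open>D\<close> is the fixed point of \<open>a \<mapsto> q a + D (1 - q)\<close>, so only the deviation from \<open>D\<close> is
  propagated, and it shrinks by \<open>q\<close> at each step.\<close>

lemma affine_growth_bound:
  fixes a :: "nat \<Rightarrow> real"
  assumes step: "\<And>i. i < r \<Longrightarrow> a (Suc i) \<le> q * a i + D * (1 - q)"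
    and q: "0 \<le> q" "q < 1" and D: "0 \<le> D" and i: "i \<le> r"
  shows "a i \<le> q ^ i * a 0 + D"
  using i
proof (induction i)
  case 0
  then show ?case using D by simp
next
  case (Suc i)
  have "a (Suc i) \<le> q * a i + D * (1 - q)" using step Suc.prems by simp
  also have "\<dots> \<le> q * (q ^ i * a 0 + D) + D * (1 - q)"
    using Suc q by (intro add_right_mono mult_left_mono) auto
  also have "\<dots> = q ^ Suc i * a 0 + D" by (simp add: algebra_simps)
  finally show ?case .
qed

text \<open>A solution that is bounded on a window is small at the middle, with a window length independent
  of the solution. For one root \<open>l\<close> and a forcing term \<open>y\<close>, the relation \<open>x (m + 1) = l x m + y m\<close> is
  run forwards from the left if \<open>|l| < 1\<close> and backwards from the right if \<open>|l| > 1\<close>; in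
  both cases the boundary value is damped by \<open>q ^ r\<close> and the forcing term, which the induction
  hypothesis makes small away from the ends, is summed in a convergent geometric series.\<close>

lemma recurrence_window_contraction:
  assumes "\<forall>l\<in>set ls. cmod l \<noteq> 1" and "e > 0"
  shows "\<exists>L. \<forall>M x n. (\<forall>m. fold shift_diff ls x m = 0) \<longrightarrow>
    (\<forall>j\<le>2 * L. cmod (x (n + j)) \<le> M) \<longrightarrow> cmod (x (n + L)) \<le> e * M"
  using assms
proof (induction ls arbitrary: e)
  case Nil
  show ?case
  proof (intro exI[of _ 0] allI impI)
    fix M :: real and x :: "nat \<Rightarrow> complex" and n
    assume "\<forall>m. fold shift_diff [] x m = 0" "\<forall>j\<le>2*0. cmod (x (n + j)) \<le> M"
    then show "cmod (x (n + 0)) \<le> e * M" using Nil(2) by simp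
  qed
next
  case (Cons l ls)
  define q where "q = (if cmod l < 1 then cmod l else inverse (cmod l))"
  have l1: "cmod l \<noteq> 1" using Cons.prems by simp
  have q: "0 \<le> q" "q < 1"
    using l1 by (auto simp: q_def inverse_less_1_iff)
  have "(\<lambda>r. q ^ r) \<longlonglongrightarrow> 0" using q by (intro LIMSEQ_realpow_zero) auto
  then have "\<forall>\<^sub>F r in sequentially. q ^ r < e / 2"
    by (rule order_tendstoD) (use \<open>e > 0\<close> in simp)
  then obtain r where r: "q ^ r < e / 2"
    by (auto simp: eventually_sequentially)
  \<comment> \<open>chosen so that a bound \<open>M\<close> for \<open>x\<close> bounds \<open>y\<close> in the inner region by \<open>(e / 2) M (1 - q)\<close>\<close>
  define e' where "e' = e / 2 * (1 - q) / (1 + cmod l)"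
  have cl: "1 + cmod l > 0" using norm_ge_zero[of l] by linarith
  have e': "e' > 0" unfolding e'_def using Cons.prems q cl by simp
  obtain L where L: "\<And>M x n. (\<forall>m. fold shift_diff ls x m = 0) \<Longrightarrow>
    (\<forall>j\<le>2 * L. cmod (x (n + j)) \<le> M) \<Longrightarrow> cmod (x (n + L)) \<le> e' * M"
    using Cons.IH[of e'] Cons.prems e' by (auto; blast)
  show ?case
  proof (intro exI[of _ "L + r + 1"] allI impI)
    fix M :: real and x :: "nat \<Rightarrow> complex" and n
    assume zero: "\<forall>m. fold shift_diff (l # ls) x m = 0"
      and bound: "\<forall>j\<le>2 * (L + r + 1). cmod (x (n + j)) \<le> M"
    define y where "y = shift_diff l x"
    define c where "c = n + (L + r + 1)"
    have bd: "cmod (x m) \<le> M" if "n \<le> m" "m \<le> n + 2 * (L + r + 1)" for m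
      using bound[rule_format, of "m - n"] that by simp
    have M: "M \<ge> 0" using bd[of n] norm_ge_zero[of "x n"] by linarith
    have y: "cmod (y m) \<le> (1 + cmod l) * M" if "n \<le> m" "m < n + 2 * (L + r + 1)" for m
    proof -
      have "cmod (y m) \<le> cmod (x (Suc m)) + cmod l * cmod (x m)"
        unfolding y_def shift_diff_def by (metis norm_mult norm_triangle_ineq4)
      also have "\<dots> \<le> M + cmod l * M"
        using bd that by (intro add_mono mult_left_mono) auto
      finally show ?thesis by (simp add: algebra_simps)
    qed
    define D where "D = e / 2 * M"
    have D: "D \<ge> 0" unfolding D_def using M Cons.prems by simp
    have ysmall: "cmod (y m) \<le> D * (1 - q)" if "n + L \<le> m" "m + L < n + 2 * (L + r + 1)" for m
    proof -
      have "cmod (y ((m - L) + L)) \<le> e' * ((1 + cmod l) * M)"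
        by (rule L) (use zero y that in \<open>auto simp: y_def\<close>)
      also have "\<dots> = D * (1 - q)"
        unfolding e'_def D_def using cl by (simp add: field_simps)
      finally show ?thesis using that by simp
    qed
    have xs: "x (Suc m) = l * x m + y m" for m by (simp add: y_def shift_diff_def)
    have "\<exists>m. n \<le> m \<and> m \<le> n + 2 * (L + r + 1) \<and> cmod (x c) \<le> q ^ r * cmod (x m) + D"
    proof (cases "cmod l < 1")
      case True
      have "cmod (x (c - r + r)) \<le> q ^ r * cmod (x (c - r + 0)) + D"
      proof (rule affine_growth_bound[where a = "\<lambda>i. cmod (x (c - r + i))" and r = r, OF _ q D])
        fix i assume "i < r"
        have "cmod (x (Suc (c - r + i))) \<le> cmod l * cmod (x (c - r + i)) + cmod (y (c - r + i))"
          unfolding xs by (metis norm_mult norm_triangle_ineq)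
        also have "\<dots> \<le> q * cmod (x (c - r + i)) + D * (1 - q)"
          using ysmall[of "c - r + i"] \<open>i < r\<close> True by (auto simp: q_def c_def)
        finally show "cmod (x (c - r + Suc i)) \<le> q * cmod (x (c - r + i)) + D * (1 - q)" by simp
      qed simp
      then show ?thesis by (intro exI[of _ "c - r"]) (auto simp: c_def add.assoc)
    next
      case False
      then have l: "cmod l > 1" using l1 by simp
      have "cmod (x (c + r - r)) \<le> q ^ r * cmod (x (c + r - 0)) + D"
      proof (rule affine_growth_bound[where a = "\<lambda>i. cmod (x (c + r - i))" and r = r, OF _ q D])
        fix i assume i: "i < r"
        define m where "m = c + r - Suc i"
        have Sm: "c + r - i = Suc m" using i by (simp add: m_def)
        have ym: "cmod (y m) \<le> D * (1 - q)"
          by (rule ysmall) (use i in \<open>auto simp: c_def m_def\<close>)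
        have "cmod l * cmod (x m) = cmod (x (Suc m) - y m)" unfolding xs by (simp add: norm_mult)
        also have "\<dots> \<le> cmod (x (Suc m)) + cmod (y m)" by (rule norm_triangle_ineq4)
        finally have "q * (cmod l * cmod (x m)) \<le> q * (cmod (x (Suc m)) + cmod (y m))"
          using q by (intro mult_left_mono)
        moreover have "l \<noteq> 0" using l by auto
        then have "q * cmod l = 1" using l by (simp add: q_def)
        ultimately have "cmod (x m) \<le> q * cmod (x (Suc m)) + q * cmod (y m)"
          by (simp add: distrib_left mult.assoc[symmetric])
        also have "q * cmod (y m) \<le> 1 * cmod (y m)" using q by (intro mult_right_mono) auto
        finally have "cmod (x m) \<le> q * cmod (x (Suc m)) + D * (1 - q)" using ym by linarith
        then show "cmod (x (c + r - Suc i)) \<le> q * cmod (x (c + r - i)) + D * (1 - q)"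
          by (simp only: Sm m_def)
      qed simp
      then show ?thesis by (intro exI[of _ "c + r"]) (auto simp: c_def add.assoc)
    qed
    then obtain m where m: "n \<le> m" "m \<le> n + 2 * (L + r + 1)" "cmod (x c) \<le> q ^ r * cmod (x m) + D"
      by blast
    note m(3)
    also have "q ^ r * cmod (x m) \<le> e / 2 * M"
      using r q bd[OF m(1,2)] M Cons.prems(2) by (intro mult_mono) auto
    finally show "cmod (x (n + (L + r + 1))) \<le> e * M" by (simp add: c_def D_def mult.commute)
  qed
qed

text \<open>Moving the window along, every \<open>L\<close> steps away from the two ends gain a factor of two.\<close>

lemma recurrence_halving:
  assumes "\<forall>l\<in>set ls. cmod l \<noteq> 1"
  shows "\<exists>L. \<forall>M x t. (\<forall>m. fold shift_diff ls x m = 0) \<longrightarrow>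
    (\<forall>j\<le>2 * L * t. cmod (x j) \<le> M) \<longrightarrow> cmod (x (L * t)) \<le> M / 2 ^ t"
proof -
  obtain L where L: "\<And>M x n. (\<forall>m. fold shift_diff ls x m = 0) \<Longrightarrow>
    (\<forall>j\<le>2 * L. cmod (x (n + j)) \<le> M) \<Longrightarrow> cmod (x (n + L)) \<le> (1/2) * M"
    using recurrence_window_contraction[OF assms, of "1/2"] by (auto; blast)
  show ?thesis
  proof (intro exI[of _ L] allI impI)
    fix M :: real and x :: "nat \<Rightarrow> complex" and t
    assume zero: "\<forall>m. fold shift_diff ls x m = 0" and bound: "\<forall>j\<le>2 * L * t. cmod (x j) \<le> M"
    have "\<forall>j. L * s \<le> j \<and> j + L * s \<le> 2 * L * t \<longrightarrow> cmod (x j) \<le> M / 2 ^ s" for s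
    proof (induction s)
      case 0
      then show ?case using bound by simp
    next
      case (Suc s)
      show ?case
      proof (intro allI impI)
        fix j assume j: "L * Suc s \<le> j \<and> j + L * Suc s \<le> 2 * L * t"
        have "cmod (x ((j - L) + L)) \<le> (1/2) * (M / 2 ^ s)"
        proof (rule L[OF zero], intro allI impI)
          fix i assume "i \<le> 2 * L"
          then have "L * s \<le> j - L + i \<and> (j - L + i) + L * s \<le> 2 * L * t" using j by auto
          then show "cmod (x (j - L + i)) \<le> M / 2 ^ s" using Suc by blast
        qed
        then show "cmod (x j) \<le> M / 2 ^ Suc s" using j by simp
      qed
    qed
    from this[of t] show "cmod (x (L * t)) \<le> M / 2 ^ t" by simp
  qed
qed

section \<open>Eigenvalue factors that annihilate vectors\<close>

definition eigen_shift :: "'a::field ^ 'n ^ 'n \<Rightarrow> 'a \<Rightarrow> 'a ^ 'n \<Rightarrow> 'a ^ 'n" where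
  "eigen_shift A l v = A *v v - l *s v"

text \<open>The vector \<open>q(A) v\<close>, evaluated by Horner's rule so that it is determined by
  its behaviour on \<open>pCons\<close>.\<close>

definition poly_apply :: "'a::field ^ 'n ^ 'n \<Rightarrow> 'a poly \<Rightarrow> 'a ^ 'n \<Rightarrow> 'a ^ 'n" where
  "poly_apply A q v = fold_coeffs (\<lambda>a w. a *s v + A *v w) q 0"

lemma poly_apply_0 [simp]: "poly_apply A 0 v = 0"
  by (simp add: poly_apply_def)

lemma poly_apply_pCons [simp]: "poly_apply A (pCons a q) v = a *s v + A *v poly_apply A q v"
  by (cases "q = 0"; cases "a = 0") (simp_all add: poly_apply_def)

lemma poly_apply_add: "poly_apply A (q + r) v = poly_apply A q v + poly_apply A r v"
  by (induction q r rule: poly_induct2)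
    (simp_all add: matrix_vector_right_distrib vec.scale_left_distrib)

lemma poly_apply_smult: "poly_apply A (smult c q) v = c *s poly_apply A q v"
  by (induction q) (simp_all add: vec.scale vec.scale_right_distrib)

lemma poly_apply_sum: "poly_apply A (\<Sum>i\<in>I. q i) v = (\<Sum>i\<in>I. poly_apply A (q i) v)"
  by (induction I rule: infinite_finite_induct) (simp_all add: poly_apply_add)

lemma poly_apply_monom: "poly_apply A (monom c j) v = c *s (matrix_power A j *v v)"
  by (induction j) (simp_all add: monom_0 monom_Suc vec.scale matrix_vector_mul_assoc)

lemma poly_apply_linear_factor:
  "poly_apply A ([:- l, 1:] * q) v = eigen_shift A l (poly_apply A q v)"
proof -
  have "[:- l, 1:] * q = smult (- l) q + pCons 0 q" by simp
  then show ?thesis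
    by (simp only: poly_apply_add poly_apply_smult poly_apply_pCons eigen_shift_def) simp
qed

lemma eigen_shift_commute: "eigen_shift A l (eigen_shift A m v) = eigen_shift A m (eigen_shift A l v)"
  by (simp add: eigen_shift_def vec.diff vec.scale vec.scale_right_diff_distrib)

lemma eigen_shift_fold: "fold (eigen_shift A) ls (eigen_shift A l v) = eigen_shift A l (fold (eigen_shift A) ls v)"
proof (induction ls arbitrary: v)
  case (Cons m ls)
  have "fold (eigen_shift A) (m # ls) (eigen_shift A l v) = fold (eigen_shift A) ls (eigen_shift A l (eigen_shift A m v))"
    by (simp only: fold_simps eigen_shift_commute[of A m l])
  then show ?case by (simp only: Cons fold_simps)
qed simp

lemma eigen_shift_fold_zero [simp]: "fold (eigen_shift A) ls 0 = 0"
  by (induction ls) (simp_all add: eigen_shift_def)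

lemma poly_apply_splits:
  fixes A :: "complex ^ 'n ^ 'n"
  assumes "q \<noteq> 0"
  shows "\<exists>ls a. a \<noteq> 0 \<and> (\<forall>v. poly_apply A q v = a *s fold (eigen_shift A) ls v)"
  using assms
proof (induction "degree q" arbitrary: q)
  case 0
  then obtain a where "q = [:a:]" by (metis degree_eq_zeroE)
  then show ?case using 0 by (intro exI[of _ "[]"] exI[of _ a]) simp
next
  case (Suc d)
  have "\<not> constant (poly q)" using Suc(2) by (simp add: constant_degree)
  then obtain l where "poly q l = 0" using fundamental_theorem_of_algebra by blast
  then obtain r where r: "q = [:- l, 1:] * r" using poly_eq_0_iff_dvd by blast
  then have "r \<noteq> 0" using Suc by auto
  then have "d = degree r" using Suc(2) unfolding r by (subst (asm) degree_mult_eq) auto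
  from Suc(1)[OF this \<open>r \<noteq> 0\<close>] obtain ls a where
    "a \<noteq> 0" and IH: "\<And>v. poly_apply A r v = a *s fold (eigen_shift A) ls v" by blast
  have "poly_apply A q v = a *s fold (eigen_shift A) (l # ls) v" for v
  proof -
    have scale: "eigen_shift A l (a *s w) = a *s eigen_shift A l w" for w
      by (simp add: eigen_shift_def vec.scale vec.scale_right_diff_distrib mult.commute)
    have "poly_apply A q v = eigen_shift A l (poly_apply A r v)"
      by (simp only: r poly_apply_linear_factor)
    also have "\<dots> = a *s eigen_shift A l (fold (eigen_shift A) ls v)"
      by (simp only: IH scale)
    also have "eigen_shift A l (fold (eigen_shift A) ls v) = fold (eigen_shift A) (l # ls) v"
      by (simp add: eigen_shift_fold)
    finally show ?thesis .
  qed
  then show ?case using \<open>a \<noteq> 0\<close> by blast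
qed

text \<open>This is stated for families instead of sets, since the powers of \<open>A\<close> applied to \<open>v\<close> may repeat.\<close>

lemma linear_relation_beyond_dimension:
  fixes v :: "nat \<Rightarrow> 'a::field ^ 'n"
  shows "\<exists>c. (\<exists>j\<le>CARD('n). c j \<noteq> 0) \<and> (\<Sum>j\<le>CARD('n). c j *s v j) = 0"
proof (cases "inj_on v {..CARD('n)}")
  case True
  let ?S = "v ` {..CARD('n)}"
  have "card ?S = Suc (CARD('n))" using True by (simp add: card_image)
  then have "vec.dependent ?S"
    using vec.dependent_biggerset_general[of ?S] dim_subset_UNIV_cart_gen[of ?S] by simp
  then obtain u where u: "(\<Sum>w\<in>?S. u w *s w) = 0" "\<exists>w\<in>?S. u w \<noteq> 0"
    using vec.dependent_finite[of ?S] by auto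
  have "(\<Sum>j\<le>CARD('n). u (v j) *s v j) = 0"
    using u(1) by (simp add: sum.reindex[OF True])
  then show ?thesis using u(2) by (intro exI[of _ "\<lambda>j. u (v j)"]) auto
next
  case False
  then obtain a b where ab: "a \<le> CARD('n)" "b \<le> CARD('n)" "a \<noteq> b" "v a = v b"
    unfolding inj_on_def by auto
  let ?c = "\<lambda>j. if j = a then 1 else if j = b then - 1 else (0::'a)"
  have "(\<Sum>j\<le>CARD('n). ?c j *s v j) = (\<Sum>j\<in>{a, b}. ?c j *s v j)"
    by (rule sum.mono_neutral_right) (use ab in auto)
  also have "\<dots> = 0" using ab by simp
  finally show ?thesis using ab by (intro exI[of _ ?c]) auto
qed

text \<open>Some nonzero polynomial in \<open>A\<close> kills \<open>v\<close>, and over the complex numbers it splits into factors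
  \<open>A - l\<close>. Take such a list of factors of minimal length. Omitting \<open>l\<close> from it leaves a
  nonzero vector, and as the factors commute that vector is an eigenvector for \<open>l\<close>.\<close>

lemma eigenvalues_annihilate_vector:
  fixes A :: "complex ^ 'n ^ 'n"
  shows "\<exists>ls. (\<forall>l\<in>set ls. eigenvalue A l) \<and> fold (eigen_shift A) ls v = 0"
proof -
  obtain c where c: "\<exists>j\<le>CARD('n). c j \<noteq> 0"
    "(\<Sum>j\<le>CARD('n). c j *s (matrix_power A j *v v)) = 0"
    using linear_relation_beyond_dimension[of "\<lambda>j. matrix_power A j *v v"] by blast
  define q where "q = (\<Sum>j\<le>CARD('n). monom (c j) j)"
  have "coeff q j = (if j \<le> CARD('n) then c j else 0)" for j
    unfolding q_def coeff_sum by (simp add: sum.delta')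
  then have "\<exists>j. coeff q j \<noteq> 0" using c(1) by auto
  then have "q \<noteq> 0" by auto
  moreover have "poly_apply A q v = 0"
    using c(2) by (simp add: q_def poly_apply_sum poly_apply_monom)
  moreover obtain ls0 a where "a \<noteq> 0" "\<And>v. poly_apply A q v = a *s fold (eigen_shift A) ls0 v"
    using poly_apply_splits[OF \<open>q \<noteq> 0\<close>, of A] by blast
  ultimately have "a *s fold (eigen_shift A) ls0 v = 0" by simp
  then have ls0: "fold (eigen_shift A) ls0 v = 0" using \<open>a \<noteq> 0\<close> by simp
  define ls where "ls = arg_min length (\<lambda>ls. fold (eigen_shift A) ls v = 0)"
  have ls: "fold (eigen_shift A) ls v = 0"
    unfolding ls_def by (rule arg_min_natI[of "\<lambda>ls. fold (eigen_shift A) ls v = 0", OF ls0])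
  have min: "length ls \<le> length ls'" if "fold (eigen_shift A) ls' v = 0" for ls'
    unfolding ls_def using that by (rule arg_min_nat_le)
  have "eigenvalue A l" if l: "l \<in> set ls" for l
  proof -
    obtain as bs where s: "ls = as @ l # bs" using l by (meson split_list)
    let ?w = "fold (eigen_shift A) (as @ bs) v"
    have "?w \<noteq> 0" using min[of "as @ bs"] s by auto
    moreover have "eigen_shift A l ?w = 0" using ls by (simp add: s eigen_shift_fold)
    then have "A *v ?w = l *s ?w" by (simp add: eigen_shift_def)
    ultimately show ?thesis unfolding eigenvalue_def by blast
  qed
  then show ?thesis using ls by blast
qed

text \<open>The list is built up vector by vector: what remains of a new vector after the old
  factors is killed by further ones, while the vectors that are already zero stay zero.\<close>

lemma eigenvalues_annihilate_finite_set:
  fixes A :: "complex ^ 'n ^ 'n"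
  assumes "finite S"
  shows "\<exists>ls. (\<forall>l\<in>set ls. eigenvalue A l) \<and> (\<forall>v\<in>S. fold (eigen_shift A) ls v = 0)"
  using assms
proof (induction S)
  case empty
  show ?case by (intro exI[of _ "[]"]) simp
next
  case (insert v S)
  then obtain ls where ls: "\<forall>l\<in>set ls. eigenvalue A l" "\<forall>v\<in>S. fold (eigen_shift A) ls v = 0"
    by blast
  obtain ms where ms: "\<forall>l\<in>set ms. eigenvalue A l"
    "fold (eigen_shift A) ms (fold (eigen_shift A) ls v) = 0"
    using eigenvalues_annihilate_vector[of A "fold (eigen_shift A) ls v"] by blast
  show ?case by (intro exI[of _ "ls @ ms"]) (use ls ms in auto)
qed

section \<open>Integer orbits of hyperbolic matrices\<close>

lemma scalar_product_add_right: "scalar_product u (v + w) = scalar_product u v + scalar_product u w"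
  by (simp add: scalar_product_def distrib_left sum.distrib)

lemma scalar_product_diff_right:
  fixes u :: "'a::ring_1 ^ 'n"
  shows "scalar_product u (v - w) = scalar_product u v - scalar_product u w"
  by (simp add: scalar_product_def right_diff_distrib sum_subtractf)

lemma scalar_product_scale_right:
  fixes u :: "'a::comm_semiring_1 ^ 'n"
  shows "scalar_product u (c *s v) = c * scalar_product u v"
  by (simp add: scalar_product_def sum_distrib_left mult.left_commute)

lemma scalar_product_0_right [simp]: "scalar_product u 0 = 0"
  by (simp add: scalar_product_def)

lemma scalar_product_axis [simp]: "scalar_product u (axis i 1) = u $ i"
  by (simp add: scalar_product_def axis_def if_distrib cong: if_cong)

lemma scalar_product_matrix:
  fixes u :: "'a::comm_semiring_1 ^ 'm"
  shows "scalar_product (u v* A) v = scalar_product u (A *v v)"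
  unfolding scalar_product_def vector_matrix_mult_def matrix_vector_mult_def
  by (simp add: sum_distrib_left sum_distrib_right mult.assoc, subst sum.swap)
     (simp add: mult.left_commute mult.commute)

lemma matrix_power_commute: "A ** matrix_power A j = matrix_power A j ** A"
  by (induction j) (simp_all add: matrix_mul_assoc)

lemma map_matrix_of_int_mult:
  "map_matrix of_int (A ** B) = map_matrix of_int A ** (map_matrix of_int B :: 'a::ring_1 ^ 'n ^ 'm)"
  by (simp add: vec_eq_iff matrix_matrix_mult_def)

lemma map_matrix_of_int_power:
  "map_matrix of_int (matrix_power A j) = (matrix_power (map_matrix of_int A) j :: 'a::ring_1 ^ 'n ^ 'n)"
  by (induction j) (simp_all add: map_matrix_of_int_mult, simp add: vec_eq_iff mat_def)

lemma det_of_int: "det (map_matrix of_int A) = (of_int (det A) :: 'a::comm_ring_1)"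
  by (simp add: det_def)

text \<open>Linear functionals of the orbit of \<open>v\<close> turn the factors \<open>A - l\<close> into \<open>E - l\<close>.\<close>

lemma dual_orbit_recurrence:
  fixes A :: "complex ^ 'n ^ 'n"
  shows "fold shift_diff ls (\<lambda>n. scalar_product u (matrix_power A n *v v)) =
    (\<lambda>n. scalar_product u (matrix_power A n *v fold (eigen_shift A) ls v))"
proof (induction ls arbitrary: v)
  case (Cons l ls)
  have "shift_diff l (\<lambda>n. scalar_product u (matrix_power A n *v v)) =
    (\<lambda>n. scalar_product u (matrix_power A n *v eigen_shift A l v))"
    by (simp add: fun_eq_iff shift_diff_def eigen_shift_def vec.diff vec.scale
        scalar_product_diff_right scalar_product_scale_right matrix_power_commute
        matrix_vector_mul_assoc)
  then show ?case using Cons by simp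
qed simp

text \<open>After \<open>t\<close> halvings a bound below \<open>2 ^ t\<close> becomes a bound below 1, and an integer of absolute
  value less than 1 is zero.\<close>

lemma hyperbolic_integer_orbit_vanishes:
  fixes A :: "int ^ 'n ^ 'n"
  assumes "\<And>l. eigenvalue (map_matrix complex_of_int A) l \<Longrightarrow> cmod l \<noteq> 1"
  shows "\<exists>L. \<forall>z t. (\<forall>j\<le>2 * L * t. \<forall>i. \<bar>(z v* matrix_power A j) $ i\<bar> < 2 ^ t) \<longrightarrow>
    z v* matrix_power A (L * t) = 0"
proof -
  let ?A = "map_matrix complex_of_int A"
  have "finite (range (\<lambda>i::'n. axis i (1::complex)))" by simp
  from eigenvalues_annihilate_finite_set[OF this] obtain ls where
    ls: "\<forall>l\<in>set ls. eigenvalue ?A l" "\<And>i. fold (eigen_shift ?A) ls (axis i 1) = 0"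
    by blast
  then have "\<forall>l\<in>set ls. cmod l \<noteq> 1" using assms by blast
  from recurrence_halving[OF this] obtain L where
    L: "\<And>M x t. (\<forall>m. fold shift_diff ls x m = 0) \<Longrightarrow>
      (\<forall>j\<le>2 * L * t. cmod (x j) \<le> M) \<Longrightarrow> cmod (x (L * t)) \<le> M / 2 ^ t"
    by blast
  show ?thesis
  proof (intro exI[of _ L] allI impI)
    fix z :: "int ^ 'n" and t
    assume small: "\<forall>j\<le>2 * L * t. \<forall>i. \<bar>(z v* matrix_power A j) $ i\<bar> < 2 ^ t"
    have "(z v* matrix_power A (L * t)) $ i = 0" for i
    proof -
      define u where "u = (\<chi> i. complex_of_int (z $ i))"
      define x where "x j = complex_of_int ((z v* matrix_power A j) $ i)" for j
      have x: "x = (\<lambda>j. scalar_product u (matrix_power ?A j *v axis i 1))"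
      proof
        fix j
        have "x j = (u v* map_matrix of_int (matrix_power A j)) $ i"
          by (simp add: x_def u_def vector_matrix_mult_def)
        also have "\<dots> = scalar_product (u v* matrix_power ?A j) (axis i 1)"
          by (simp add: map_matrix_of_int_power)
        finally show "x j = scalar_product u (matrix_power ?A j *v axis i 1)"
          by (simp only: scalar_product_matrix)
      qed
      have "\<forall>m. fold shift_diff ls x m = 0"
        unfolding x dual_orbit_recurrence ls(2) by simp
      moreover have "\<forall>j\<le>2 * L * t. cmod (x j) \<le> 2 ^ t - 1"
      proof (intro allI impI)
        fix j assume "j \<le> 2 * L * t"
        then have "\<bar>(z v* matrix_power A j) $ i\<bar> \<le> 2 ^ t - 1" using small by force
        then have "real_of_int \<bar>(z v* matrix_power A j) $ i\<bar> \<le> real_of_int (2 ^ t - 1)"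
          by (simp only: of_int_le_iff)
        then show "cmod (x j) \<le> 2 ^ t - 1" by (simp add: x_def)
      qed
      ultimately have "cmod (x (L * t)) \<le> (2 ^ t - 1) / 2 ^ t" by (rule L)
      also have "\<dots> < 1" by (simp add: field_simps)
      finally show ?thesis by (simp add: x_def)
    qed
    then show "z v* matrix_power A (L * t) = 0" by (simp add: vec_eq_iff)
  qed
qed

text \<open>The entries of \<open>C\<close> are those of Cramer's rule before the division by the determinant.
  Keeping the determinant as the only scalar matters later, because it is the quantity that is
  coprime to the modulus.\<close>

lemma exists_integer_adjugate:
  fixes B :: "int ^ 'n ^ 'n"
  assumes "det B \<noteq> 0"
  shows "\<exists>C. B ** C = mat (det B)"
proof -
  let ?B = "map_matrix real_of_int B"
  have nz: "det ?B \<noteq> 0" using assms by (simp add: det_of_int)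
  define C :: "int ^ 'n ^ 'n" where
    "C = (\<chi> k l. det (\<chi> i j. if j = k then (if i = l then 1 else 0) else B $ i $ j))"
  have "(?B ** map_matrix of_int C) = mat (det ?B)"
  proof -
    have col: "?B *v (\<chi> k. real_of_int (C $ k $ l)) = det ?B *s axis l 1" for l
    proof -
      let ?c = "\<chi> k. det (\<chi> i j. if j = k then axis l 1 $ i else ?B $ i $ j) / det ?B"
      have "?B *v ?c = axis l 1" using cramer[OF nz] by blast
      moreover have "(\<chi> k. real_of_int (C $ k $ l)) = det ?B *s ?c"
      proof -
        have "real_of_int (C $ k $ l) = det (\<chi> i j. if j = k then axis l 1 $ i else ?B $ i $ j)" for k
          unfolding C_def vec_lambda_beta det_of_int[symmetric]
          by (rule arg_cong[where f = det]) (simp add: vec_eq_iff axis_def)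
        then show ?thesis using nz by (simp add: vec_eq_iff)
      qed
      ultimately show ?thesis by (simp add: vec.scale)
    qed
    show ?thesis
    proof (simp add: vec_eq_iff, intro allI)
      fix i l
      have "(?B ** map_matrix of_int C) $ i $ l = (?B *v (\<chi> k. real_of_int (C $ k $ l))) $ i"
        by (simp add: matrix_matrix_mult_def matrix_vector_mult_def)
      also have "\<dots> = mat (det ?B) $ i $ l"
        unfolding col by (auto simp: mat_def axis_def)
      finally show "(?B ** map_matrix of_int C) $ i $ l = mat (det ?B) $ i $ l" .
    qed
  qed
  then have "map_matrix real_of_int (B ** C) = map_matrix real_of_int (mat (det B))"
    by (simp add: map_matrix_of_int_mult det_of_int) (simp add: vec_eq_iff mat_def)
  then have "B ** C = mat (det B)" by (simp add: vec_eq_iff)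
  then show ?thesis by blast
qed

lemma vector_matrix_mat [simp]:
  fixes v :: "'a::comm_semiring_1 ^ 'n"
  shows "v v* mat c = c *s v"
  by (simp add: vec_eq_iff vector_matrix_mult_def mat_def if_distrib mult.commute cong: if_cong)

section \<open>Escape of dual orbits modulo p\<close>

lemma vector_matrix_scale_left:
  fixes v :: "'a::comm_semiring_1 ^ 'm"
  shows "(c *s v) v* M = c *s (v v* M)"
  by (simp add: vec_eq_iff vector_matrix_mult_def sum_distrib_left mult.assoc mult.left_commute)

lemma dvd_vector_matrix:
  fixes v :: "int ^ 'm"
  assumes "\<And>i. d dvd v $ i"
  shows "d dvd (v v* M) $ j"
  unfolding vector_matrix_mult_def vec_lambda_beta
  by (intro dvd_sum dvd_mult2 assms)

lemma abs_vector_matrix_le: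
  fixes v :: "int ^ 'm" and R :: real
  assumes "\<And>i. \<bar>real_of_int (v $ i)\<bar> \<le> R"
  shows "\<bar>real_of_int ((v v* M) $ j)\<bar> \<le> R * (\<Sum>l\<in>UNIV. \<Sum>m\<in>UNIV. \<bar>real_of_int (M $ l $ m)\<bar>)"
proof -
  have "\<bar>real_of_int ((v v* M) $ j)\<bar> \<le> (\<Sum>l\<in>UNIV. \<bar>real_of_int (M $ l $ j)\<bar> * \<bar>real_of_int (v $ l)\<bar>)"
    unfolding vector_matrix_mult_def vec_lambda_beta of_int_sum of_int_mult
    by (rule order_trans[OF sum_abs]) (simp add: abs_mult mult.commute)
  also have "\<dots> \<le> (\<Sum>l\<in>UNIV. (\<Sum>m\<in>UNIV. \<bar>real_of_int (M $ l $ m)\<bar>) * R)"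
    by (intro sum_mono mult_mono assms member_le_sum) (auto intro: sum_nonneg)
  finally show ?thesis by (simp add: sum_distrib_left mult.commute)
qed

text \<open>A matrix whose determinant is coprime to \<open>d\<close> acts injectively modulo \<open>d\<close>, its inverse being the
  adjugate up to a unit.\<close>

lemma coprime_det_dvd_cancel:
  fixes A :: "int ^ 'n ^ 'n"
  assumes cop: "coprime (det A) d" and dvd: "\<And>i. d dvd (v v* A) $ i"
  shows "d dvd v $ i"
proof (cases "det A = 0")
  case True
  then show ?thesis using cop by (auto intro: unit_imp_dvd)
next
  case False
  then obtain C where C: "A ** C = mat (det A)" using exists_integer_adjugate by blast
  have "d dvd ((v v* A) v* C) $ i" using dvd by (rule dvd_vector_matrix)
  then have "d dvd det A * v $ i" by (simp add: vector_matrix_mul_assoc C)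
  then show ?thesis using cop by (simp add: coprime_dvd_mult_right_iff coprime_commute)
qed

lemma coprime_det_dvd_cancel_power:
  fixes A :: "int ^ 'n ^ 'n"
  assumes cop: "coprime (det A) d"
  shows "(\<And>i. d dvd (v v* matrix_power A j) $ i) \<Longrightarrow> d dvd v $ i"
proof (induction j arbitrary: v i)
  case (Suc j)
  have "d dvd ((v v* A) v* matrix_power A j) $ i" for i
    using Suc.prems by (simp add: vector_matrix_mul_assoc)
  then have "d dvd (v v* A) $ i" for i by (rule Suc.IH)
  then show ?case by (rule coprime_det_dvd_cancel[OF cop])
qed simp

text \<open>Phrased with the small representative \<open>w\<close> of \<open>s\<close> rather than with a distance, because the lifting
  argument computes with these representatives.\<close>

definition near_multiple :: "real \<Rightarrow> nat \<Rightarrow> int \<Rightarrow> bool" where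
  "near_multiple \<delta> p s \<longleftrightarrow> (\<exists>w. int p dvd s - w \<and> \<bar>real_of_int w\<bar> < \<delta> * real p)"

text \<open>If every \<open>\<alpha> A\<^sup>j B\<close> were near a multiple of \<open>p\<close>, the orbit of \<open>\<alpha>\<close> modulo \<open>p\<close> would lift, up to the
  factor \<open>det B\<close>, to an orbit of small integer vectors, and these have to vanish. The constant
  \<open>\<delta>\<close> is chosen so that the defect of the lifted recurrence stays below \<open>p\<close>.\<close>

lemma dual_orbit_escapes:
  fixes A B :: "int ^ 'n ^ 'n"
  assumes eig: "\<And>l. eigenvalue (map_matrix complex_of_int A) l \<Longrightarrow> cmod l \<noteq> 1"
  shows "\<exists>\<delta> L. 0 < \<delta> \<and> \<delta> \<le> 1 \<and> (\<forall>p t \<alpha>. coprime (det A) (int p) \<longrightarrow> coprime (det B) (int p) \<longrightarrow>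
    p \<le> 2 ^ t \<longrightarrow> \<not> (\<forall>i. int p dvd \<alpha> $ i) \<longrightarrow>
    (\<exists>j\<le>2 * L * t. \<exists>i. \<not> near_multiple \<delta> p ((\<alpha> v* matrix_power A j v* B) $ i)))"
proof (cases "det B = 0")
  case True
  \<comment> \<open>only \<open>p = 1\<close> is coprime to 0, and it divides everything\<close>
  show ?thesis
    by (rule exI[of _ 1], rule exI[of _ 0]) (use True in \<open>auto intro: unit_imp_dvd\<close>)
next
  case False
  then obtain C where C: "B ** C = mat (det B)" using exists_integer_adjugate by blast
  obtain L where L: "\<And>z t. (\<forall>j\<le>2 * L * t. \<forall>i. \<bar>(z v* matrix_power A j) $ i\<bar> < 2 ^ t) \<Longrightarrow>
    z v* matrix_power A (L * t) = 0"
    using hyperbolic_integer_orbit_vanishes[OF eig] by blast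
  define KA where "KA = (\<Sum>l\<in>UNIV. \<Sum>m\<in>UNIV. \<bar>real_of_int (A $ l $ m)\<bar>)"
  define KC where "KC = (\<Sum>l\<in>UNIV. \<Sum>m\<in>UNIV. \<bar>real_of_int (C $ l $ m)\<bar>)"
  have K: "KA \<ge> 0" "KC \<ge> 0" by (auto simp: KA_def KC_def intro!: sum_nonneg)
  define \<delta> where "\<delta> = 1 / ((KC + 1) * (KA + 1))"
  have den: "(KC + 1) * (KA + 1) \<ge> 1" using K by (simp add: algebra_simps)
  then have \<delta>: "0 < \<delta>" "\<delta> \<le> 1" by (auto simp: \<delta>_def)
  have "\<delta> * KC * (KA + 1) = KC / (KC + 1)"
  proof -
    have "KA + 1 \<noteq> 0" "KC + 1 \<noteq> 0" using K by auto
    then show ?thesis by (simp add: \<delta>_def)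
  qed
  also have "\<dots> < 1" using K by simp
  finally have \<delta>K: "\<delta> * KC * (KA + 1) < 1" .
  show ?thesis
  proof (rule exI[of _ \<delta>], rule exI[of _ L], intro conjI allI impI, fact, fact)
    fix p t :: nat and \<alpha> :: "int ^ 'n"
    assume copA: "coprime (det A) (int p)" and copB: "coprime (det B) (int p)"
      and pt: "p \<le> 2 ^ t" and nz: "\<not> (\<forall>i. int p dvd \<alpha> $ i)"
    show "\<exists>j\<le>2 * L * t. \<exists>i. \<not> near_multiple \<delta> p ((\<alpha> v* matrix_power A j v* B) $ i)"
    proof (rule ccontr)
      assume "\<not> ?thesis"
      then have near: "near_multiple \<delta> p ((\<alpha> v* matrix_power A j v* B) $ i)" if "j \<le> 2 * L * t" for i j
        using that by blast
      define W where "W j = (\<chi> i. SOME w. int p dvd (\<alpha> v* matrix_power A j v* B) $ i - w \<and>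
        \<bar>real_of_int w\<bar> < \<delta> * real p)" for j
      have W: "int p dvd (\<alpha> v* matrix_power A j v* B) $ i - W j $ i \<and>
        \<bar>real_of_int (W j $ i)\<bar> < \<delta> * real p" if "j \<le> 2 * L * t" for i j
        unfolding W_def vec_lambda_beta
        using near[OF that, of i] unfolding near_multiple_def by (rule someI_ex)
      have p: "real p > 0"
      proof (rule ccontr)
        assume "\<not> real p > 0"
        then show False using W[of 0] by simp
      qed
      define z where "z j = W j v* C" for j
      have z_cong: "int p dvd det B * (\<alpha> v* matrix_power A j) $ i - z j $ i" if "j \<le> 2 * L * t" for i j
      proof -
        have "int p dvd ((\<alpha> v* matrix_power A j v* B - W j) v* C) $ i"
          by (rule dvd_vector_matrix) (use W[OF that] in simp)
        moreover have "\<alpha> v* matrix_power A j v* B v* C = det B *s (\<alpha> v* matrix_power A j)"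
          by (simp only: vector_matrix_mul_assoc[of _ B C] C vector_matrix_mat)
        ultimately show ?thesis
          by (simp add: z_def vector_matrix_mult_diff_distrib)
      qed
      have z_le: "\<bar>real_of_int (z j $ i)\<bar> \<le> \<delta> * real p * KC" if "j \<le> 2 * L * t" for i j
        unfolding z_def KC_def by (rule abs_vector_matrix_le) (use W[OF that] in \<open>simp add: less_imp_le\<close>)
      \<comment> \<open>the defect is divisible by \<open>p\<close> and smaller than \<open>p\<close>\<close>
      have z_step: "z (Suc j) = z j v* A" if j: "Suc j \<le> 2 * L * t" for j
      proof -
        have "z (Suc j) $ i - (z j v* A) $ i = 0" for i
        proof (rule ccontr)
          assume ne: "z (Suc j) $ i - (z j v* A) $ i \<noteq> 0"
          have "int p dvd ((det B *s (\<alpha> v* matrix_power A j) - z j) v* A) $ i"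
            by (rule dvd_vector_matrix) (use z_cong[of j] j in simp)
          moreover have "((det B *s (\<alpha> v* matrix_power A j)) v* A) $ i = det B * (\<alpha> v* matrix_power A (Suc j)) $ i"
          proof -
            show ?thesis
              by (simp add: vector_matrix_scale_left vector_matrix_mul_assoc matrix_power_commute)
          qed
          ultimately have "int p dvd det B * (\<alpha> v* matrix_power A (Suc j)) $ i - (z j v* A) $ i"
            by (simp add: vector_matrix_mult_diff_distrib)
          moreover have "int p dvd det B * (\<alpha> v* matrix_power A (Suc j)) $ i - z (Suc j) $ i"
            by (rule z_cong[OF j])
          ultimately have "int p dvd (det B * (\<alpha> v* matrix_power A (Suc j)) $ i - (z j v* A) $ i) -
              (det B * (\<alpha> v* matrix_power A (Suc j)) $ i - z (Suc j) $ i)" by (rule dvd_diff)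
          then have "int p dvd z (Suc j) $ i - (z j v* A) $ i" by simp
          from dvd_imp_le_int[OF ne this]
          have "int p \<le> \<bar>z (Suc j) $ i - (z j v* A) $ i\<bar>" by simp
          then have "real p \<le> \<bar>real_of_int (z (Suc j) $ i) - real_of_int ((z j v* A) $ i)\<bar>"
            by linarith
          also have "\<dots> \<le> \<bar>real_of_int (z (Suc j) $ i)\<bar> + \<bar>real_of_int ((z j v* A) $ i)\<bar>"
            by (rule abs_triangle_ineq4)
          also have "\<dots> \<le> \<delta> * real p * KC + (\<delta> * real p * KC) * KA"
            unfolding KA_def by (intro add_mono z_le j abs_vector_matrix_le) (use j in simp)
          also have "\<dots> = (\<delta> * KC * (KA + 1)) * real p" by (simp add: algebra_simps)
          also have "\<dots> < 1 * real p" using \<delta>K p by (intro mult_strict_right_mono)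
          finally show False by simp
        qed
        then show ?thesis by (simp add: vec_eq_iff)
      qed
      have orbit: "j \<le> 2 * L * t \<Longrightarrow> z 0 v* matrix_power A j = z j" for j
      proof (induction j)
        case (Suc j)
        have "z 0 v* matrix_power A (Suc j) = (z 0 v* matrix_power A j) v* A"
          by (simp add: vector_matrix_mul_assoc matrix_power_commute)
        then show ?case using Suc z_step by simp
      qed simp
      have "z 0 v* matrix_power A (L * t) = 0"
      proof (rule L, intro allI impI)
        fix j i assume j: "j \<le> 2 * L * t"
        have "\<bar>real_of_int (z j $ i)\<bar> \<le> \<delta> * real p * KC" by (rule z_le[OF j])
        also have "\<dots> \<le> (\<delta> * KC * (KA + 1)) * real p"
          using K \<delta>(1) by (simp add: algebra_simps)
        also have "\<dots> < 1 * real p" using \<delta>K p by (intro mult_strict_right_mono)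
        also have "1 * real p \<le> real (2 ^ t)" using pt by (simp only: mult_1 of_nat_le_iff)
        finally have "real_of_int \<bar>z j $ i\<bar> < real_of_int (2 ^ t)" by simp
        then show "\<bar>(z 0 v* matrix_power A j) $ i\<bar> < 2 ^ t"
          unfolding orbit[OF j] by (simp only: of_int_less_iff)
      qed
      then have "z (L * t) = 0" using orbit[of "L * t"] by simp
      then have "int p dvd det B * (\<alpha> v* matrix_power A (L * t)) $ i" for i
        using z_cong[of "L * t" i] by simp
      then have "int p dvd (\<alpha> v* matrix_power A (L * t)) $ i" for i
        using copB by (simp add: coprime_dvd_mult_right_iff coprime_commute)
      then have "int p dvd \<alpha> $ i" for i by (rule coprime_det_dvd_cancel_power[OF copA])
      then show False using nz by blast
    qed
  qed
qed

section \<open>Characters modulo p and Fourier inversion\<close>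

text \<open>The standard additive character of the integers modulo \<open>p\<close>.\<close>

definition mod_char :: "nat \<Rightarrow> int \<Rightarrow> complex" where
  "mod_char p t = cis (2 * pi * real_of_int t / real p)"

lemma mod_char_0 [simp]: "mod_char p 0 = 1"
  by (simp add: mod_char_def)

lemma mod_char_add: "mod_char p (s + t) = mod_char p s * mod_char p t"
  by (simp add: mod_char_def cis_mult add_divide_distrib distrib_left)

lemma mod_char_diff: "mod_char p (s - t) = mod_char p s * cnj (mod_char p t)"
  by (simp add: mod_char_def cis_cnj cis_mult diff_divide_distrib right_diff_distrib)

lemma mod_char_sum: "mod_char p (\<Sum>i\<in>I. f i) = (\<Prod>i\<in>I. mod_char p (f i))"
  by (induction I rule: infinite_finite_induct) (simp_all add: mod_char_add)

lemma norm_mod_char [simp]: "cmod (mod_char p t) = 1"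
  by (simp add: mod_char_def)

lemma mod_char_mult_nat: "mod_char p (t * int n) = mod_char p t ^ n"
  by (induction n) (simp_all add: mod_char_add distrib_left)

lemma mod_char_period: "p > 0 \<Longrightarrow> mod_char p (int p * t) = 1"
  using cis_multiple_2pi[of "real_of_int t"] by (simp add: mod_char_def mult.assoc)

lemma mod_char_cong:
  assumes "p > 0" "int p dvd s - t"
  shows "mod_char p s = mod_char p t"
proof -
  obtain k where "s - t = int p * k" using assms(2) by blast
  then have "s = t + int p * k" by simp
  then show ?thesis using assms(1) by (simp add: mod_char_add mod_char_period)
qed

lemma mod_char_eq_1_iff:
  assumes "p > 0"
  shows "mod_char p t = 1 \<longleftrightarrow> int p dvd t"
proof
  assume 1: "mod_char p t = 1"
  have "cos (2 * pi * real_of_int t / real p) = Re (mod_char p t)" by (simp add: mod_char_def)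
  also have "\<dots> = 1" by (simp add: 1)
  finally have "cos (2 * pi * real_of_int t / real p) = 1" .
  then obtain n :: int where "2 * pi * real_of_int t / real p = of_int n * 2 * pi"
    unfolding cos_one_2pi_int by auto
  then have "real_of_int t = real_of_int (n * int p)" using assms by (simp add: field_simps)
  then show "int p dvd t" by (simp only: of_int_eq_iff) simp
next
  assume "int p dvd t"
  then show "mod_char p t = 1" using mod_char_cong[OF assms, of t 0] by simp
qed

lemma sum_mod_char:
  assumes "p > 0"
  shows "(\<Sum>a\<in>{0..<int p}. mod_char p (a * t)) = (if int p dvd t then of_nat p else 0)"
proof -
  have "(\<Sum>a\<in>{0..<int p}. mod_char p (a * t)) = (\<Sum>n<p. mod_char p t ^ n)"
  proof (rule sum.reindex_bij_witness[of _ int nat])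
    fix a assume "a \<in> {0..<int p}"
    then show "mod_char p t ^ nat a = mod_char p (a * t)"
      using mod_char_mult_nat[of p t "nat a"] by (simp add: mult.commute)
  qed auto
  also have "\<dots> = (if int p dvd t then of_nat p else 0)"
  proof (cases "int p dvd t")
    case True
    then have "mod_char p t = 1" using mod_char_eq_1_iff[OF assms] by simp
    then show ?thesis using True by simp
  next
    case False
    then have "mod_char p t \<noteq> 1" using mod_char_eq_1_iff[OF assms] by simp
    \<comment> \<open>a geometric sum over all powers of a nontrivial root of unity\<close>
    moreover have "mod_char p t ^ p = 1"
      using mod_char_period[OF assms, of t] mod_char_mult_nat[of p t p] by (simp add: mult.commute)
    ultimately show ?thesis using False by (simp add: sum_gp_strict)
  qed
  finally show ?thesis .
qed

lemma bij_betw_vec_lambda_Z_mod: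
  "bij_betw (\<lambda>g. \<chi> i. g i) (PiE UNIV (\<lambda>_. {0..<int p})) (Z_mod p)"
  by (rule bij_betwI[where g = "\<lambda>x i. x $ i"]) (auto simp: Z_mod_def PiE_def Pi_def)

lemma finite_Z_mod [simp]: "finite (Z_mod p :: (int ^ 'n) set)"
proof -
  have "finite (PiE (UNIV :: 'n set) (\<lambda>_. {0..<int p}))" by (rule finite_PiE) auto
  then show ?thesis using bij_betw_finite[OF bij_betw_vec_lambda_Z_mod] by blast
qed

lemma card_Z_mod: "card (Z_mod p :: (int ^ 'n) set) = p ^ CARD('n)"
  using bij_betw_same_card[OF bij_betw_vec_lambda_Z_mod[where 'a = 'n]] by (simp add: card_PiE)

text \<open>Orthogonality of characters: the sum over frequency vectors factors into one geometric sum per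
  coordinate.\<close>

lemma sum_mod_char_vec:
  fixes y :: "int ^ 'n"
  assumes "p > 0"
  shows "(\<Sum>\<alpha>\<in>Z_mod p. mod_char p (scalar_product \<alpha> y)) =
    (if \<forall>i. int p dvd y $ i then of_nat (p ^ CARD('n)) else 0)"
proof -
  have "(\<Sum>\<alpha>\<in>Z_mod p. mod_char p (scalar_product \<alpha> y)) =
      (\<Sum>g\<in>PiE UNIV (\<lambda>_. {0..<int p}). \<Prod>i\<in>UNIV. mod_char p (g i * y $ i))"
    by (subst sum.reindex_bij_betw[OF bij_betw_vec_lambda_Z_mod, symmetric])
       (simp add: scalar_product_def mod_char_sum)
  also have "\<dots> = (\<Prod>i\<in>UNIV. \<Sum>a\<in>{0..<int p}. mod_char p (a * y $ i))"
    by (rule prod_sum_PiE[symmetric]) auto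
  also have "\<dots> = (if \<forall>i. int p dvd y $ i then of_nat (p ^ CARD('n)) else 0)"
    by (auto simp: sum_mod_char[OF assms])
  finally show ?thesis .
qed

lemma Z_mod_eq_iff:
  assumes "x \<in> Z_mod p" "y \<in> Z_mod p"
  shows "x = y \<longleftrightarrow> (\<forall>i. int p dvd (x - y) $ i)"
proof
  assume d: "\<forall>i. int p dvd (x - y) $ i"
  have "x $ i = y $ i" for i
  proof -
    have "x $ i mod int p = y $ i mod int p" using d by (simp add: mod_eq_dvd_iff)
    moreover have "x $ i mod int p = x $ i" "y $ i mod int p = y $ i"
      using assms by (simp_all add: Z_mod_def)
    ultimately show ?thesis by simp
  qed
  then show "x = y" by (simp add: vec_eq_iff)
qed simp

text \<open>By Fourier inversion the point masses of \<open>Q\<close> are averages of the Fourier coefficients, and the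
  zero frequency accounts for the uniform mass. Bounding the remaining terms by the triangle inequality
  loses a factor against the Cauchy-Schwarz bound, but only a power of \<open>p\<close>, which the decay of the coefficients absorbs.\<close>
lemma variation_distance_uniform_le_sum_char:
  fixes Q :: "(int ^ 'n) measure"
  assumes p: "p > 0" and Q: "prob_space Q" "sets Q = sets (count_space (Z_mod p))"
  shows "variation_distance (Z_mod p) Q (uniform_count_measure (Z_mod p)) \<le>
    (\<Sum>\<alpha>\<in>Z_mod p - {0}. cmod (\<integral>x. mod_char p (scalar_product \<alpha> x) \<partial>Q))"
proof -
  interpret prob_space Q by fact
  have sp: "space Q = Z_mod p" using sets_eq_imp_space_eq[OF Q(2)] by simp
  define N where "N = real (p ^ CARD('n))"
  have N: "N > 0" using p by (simp add: N_def)
  define S where "S = (\<Sum>\<alpha>\<in>Z_mod p - {0}. cmod (\<integral>x. mod_char p (scalar_product \<alpha> x) \<partial>Q))"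
  have 0: "0 \<in> Z_mod p" using p by (simp add: Z_mod_def)
  have meas: "f \<in> borel_measurable Q" for f :: "int ^ 'n \<Rightarrow> complex"
    by (simp add: measurable_cong_sets[OF Q(2) refl])
  have int: "integrable Q f" if "\<And>x. cmod (f x) \<le> 1" for f
    by (rule integrable_const_bound[where B = 1]) (use that meas in auto)
  have main: "\<bar>measure Q {x} - 1 / N\<bar> \<le> S / N" if x: "x \<in> Z_mod p" for x
  proof -
    have xs: "{x} \<in> sets Q" using x Q(2) by simp
    define F where "F \<alpha> = (\<integral>y. mod_char p (scalar_product \<alpha> (y - x)) \<partial>Q)" for \<alpha>
    have F: "F \<alpha> = cnj (mod_char p (scalar_product \<alpha> x)) * (\<integral>y. mod_char p (scalar_product \<alpha> y) \<partial>Q)" for \<alpha>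
      unfolding F_def scalar_product_diff_right mod_char_diff
      by (simp add: mult.commute)
    have "(\<Sum>\<alpha>\<in>Z_mod p. F \<alpha>) = (\<integral>y. (\<Sum>\<alpha>\<in>Z_mod p. mod_char p (scalar_product \<alpha> (y - x))) \<partial>Q)"
      unfolding F_def by (rule Bochner_Integration.integral_sum[symmetric]) (auto intro: int)
    also have "\<dots> = (\<integral>y. of_real N * of_real (indicator {x} y) \<partial>Q)"
    proof (rule Bochner_Integration.integral_cong[OF refl])
      fix y assume "y \<in> space Q"
      then have "x = y \<longleftrightarrow> (\<forall>i. int p dvd (y - x) $ i)"
        using Z_mod_eq_iff[of y p x] x sp by auto
      then show "(\<Sum>\<alpha>\<in>Z_mod p. mod_char p (scalar_product \<alpha> (y - x))) = of_real N * of_real (indicator {x} y)"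
        by (simp only: sum_mod_char_vec[OF p]) (auto simp: N_def indicator_def)
    qed
    also have "\<dots> = of_real (N * measure Q {x})"
      using xs by (simp flip: of_real_mult)
    finally have eq: "of_real (N * measure Q {x}) = (\<Sum>\<alpha>\<in>Z_mod p. F \<alpha>)" by simp
    have "(\<Sum>\<alpha>\<in>Z_mod p. F \<alpha>) = F 0 + (\<Sum>\<alpha>\<in>Z_mod p - {0}. F \<alpha>)"
      by (rule sum.remove[OF finite_Z_mod 0])
    also have "F 0 = 1" by (simp add: F_def scalar_product_def prob_space)
    finally have "of_real (N * measure Q {x} - 1) = (\<Sum>\<alpha>\<in>Z_mod p - {0}. F \<alpha>)"
      by (simp add: eq[symmetric])
    then have "cmod (of_real (N * measure Q {x} - 1)) = cmod (\<Sum>\<alpha>\<in>Z_mod p - {0}. F \<alpha>)"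
      by simp
    then have "\<bar>N * measure Q {x} - 1\<bar> = cmod (\<Sum>\<alpha>\<in>Z_mod p - {0}. F \<alpha>)"
      by (simp only: norm_of_real)
    also have "\<dots> \<le> (\<Sum>\<alpha>\<in>Z_mod p - {0}. cmod (F \<alpha>))" by (rule norm_sum)
    also have "\<dots> = S" by (simp add: S_def F norm_mult)
    finally have "\<bar>N * measure Q {x} - 1\<bar> / N \<le> S / N" using N by (simp add: divide_right_mono)
    moreover have "\<bar>N * measure Q {x} - 1\<bar> / N = \<bar>measure Q {x} - 1 / N\<bar>"
    proof -
      have "N * measure Q {x} - 1 = (measure Q {x} - 1 / N) * N" using N by (simp add: field_simps)
      then show ?thesis using N by (simp only: abs_mult) simp
    qed
    ultimately show ?thesis by simp
  qed
  have U: "measure (uniform_count_measure (Z_mod p)) {x} = 1 / N" if "x \<in> Z_mod p" for x :: "int ^ 'n"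
    using that by (subst measure_uniform_count_measure) (auto simp: card_Z_mod N_def)
  have "variation_distance (Z_mod p) Q (uniform_count_measure (Z_mod p)) \<le> 1 / 2 * (\<Sum>x\<in>(Z_mod p :: (int ^ 'n) set). S / N)"
    unfolding variation_distance_def by (intro mult_left_mono sum_mono) (use U main in auto)
  also have "\<dots> = S / 2" using N by (simp add: card_Z_mod N_def)
  also have "\<dots> \<le> S" unfolding S_def by (simp add: sum_nonneg)
  finally show ?thesis by (simp add: S_def)
qed

section \<open>The Fourier transform of the walk\<close>

lemma matrix_power_add: "matrix_power A (i + j) = matrix_power A i ** matrix_power A j"
  by (induction i) (simp_all add: matrix_mul_assoc)

lemma scalar_product_vec_mod:
  "int p dvd scalar_product \<alpha> (vec_mod x p) - scalar_product \<alpha> x"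
proof -
  have "int p dvd \<alpha> $ i * (x $ i mod int p - x $ i)" for i
    by (intro dvd_mult) (simp add: mod_eq_dvd_iff[symmetric])
  then have "int p dvd (\<Sum>i\<in>UNIV. \<alpha> $ i * (x $ i mod int p - x $ i))" by (intro dvd_sum)
  then show ?thesis
    by (simp add: scalar_product_def vec_mod_def right_diff_distrib sum_subtractf)
qed

text \<open>Unrolling the recursion moves the powers of \<open>A\<close> from the state onto the frequency, where they act
  from the right. The increment entering with \<open>A\<^sup>j\<close> is the one added \<open>j + 1\<close> steps before time \<open>n\<close>.\<close>

lemma mod_char_walk:
  assumes p: "p > 0"
  shows "mod_char p (scalar_product \<alpha> (walk A b x0 p n \<omega>)) =
    mod_char p (scalar_product (\<alpha> v* matrix_power A n) x0) *
    (\<Prod>j<n. mod_char p (scalar_product (\<alpha> v* matrix_power A j) (b (n - Suc j) \<omega>)))"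
proof (induction n arbitrary: \<alpha>)
  case 0
  show ?case using mod_char_cong[OF p scalar_product_vec_mod] by simp
next
  case (Suc n)
  have "mod_char p (scalar_product \<alpha> (walk A b x0 p (Suc n) \<omega>)) =
      mod_char p (scalar_product \<alpha> (A *v walk A b x0 p n \<omega> + b n \<omega>))"
    using mod_char_cong[OF p scalar_product_vec_mod] by simp
  also have "\<dots> = mod_char p (scalar_product (\<alpha> v* A) (walk A b x0 p n \<omega>)) *
      mod_char p (scalar_product \<alpha> (b n \<omega>))"
    by (simp only: scalar_product_add_right mod_char_add scalar_product_matrix)
  also have "\<dots> = mod_char p (scalar_product (\<alpha> v* matrix_power A (Suc n)) x0) *
      ((\<Prod>j<n. mod_char p (scalar_product (\<alpha> v* matrix_power A (Suc j)) (b (n - Suc j) \<omega>))) *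
      mod_char p (scalar_product \<alpha> (b n \<omega>)))"
    by (simp add: Suc.IH vector_matrix_mul_assoc)
  also have "(\<Prod>j<n. mod_char p (scalar_product (\<alpha> v* matrix_power A (Suc j)) (b (n - Suc j) \<omega>))) *
      mod_char p (scalar_product \<alpha> (b n \<omega>)) =
      (\<Prod>j<Suc n. mod_char p (scalar_product (\<alpha> v* matrix_power A j) (b (Suc n - Suc j) \<omega>)))"
    by (simp only: prod.lessThan_Suc_shift) (simp add: mult.commute)
  finally show ?case .
qed

lemma walk_in_Z_mod: "p > 0 \<Longrightarrow> walk A b x0 p n \<omega> \<in> Z_mod p"
  by (cases n) (simp_all add: Z_mod_def vec_mod_def)

text \<open>The state at time \<open>n\<close> takes countably many values, so measurability of the next state can be
  checked separately on each event where the present state is fixed.\<close>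

lemma measurable_walk:
  fixes b :: "nat \<Rightarrow> 'w \<Rightarrow> int ^ 'n"
  assumes p: "p > 0" and b: "\<And>n. b n \<in> measurable M (count_space UNIV)"
  shows "walk A b x0 p n \<in> measurable M (count_space (Z_mod p))"
proof -
  have U: "walk A b x0 p n \<in> measurable M (count_space UNIV)"
  proof (induction n)
    case (Suc n)
    have "(\<lambda>\<omega>. vec_mod (A *v w + b n \<omega>) p) \<in> measurable M (count_space UNIV)" for w
      by (rule measurable_compose[OF b]) simp
    from measurable_compose_countable[OF this Suc] show ?case by simp
  qed simp
  show ?thesis
    unfolding measurable_count_space_eq2[OF finite_Z_mod]
    using measurable_sets[OF U] walk_in_Z_mod[OF p, of A b x0] by auto
qed

lemma norm_char_walk_law:
  fixes b :: "nat \<Rightarrow> 'w \<Rightarrow> int ^ 'n" and \<mu> :: "(int ^ 'n) pmf"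
  assumes M: "prob_space M" and p: "p > 0"
    and indep: "prob_space.indep_vars M (\<lambda>_. count_space UNIV) b UNIV"
    and law: "\<And>n. distr M (count_space UNIV) (b n) = measure_pmf \<mu>"
  shows "cmod (\<integral>x. mod_char p (scalar_product \<alpha> x) \<partial>walk_law M A b x0 p n) =
    (\<Prod>j<n. cmod (\<integral>x. mod_char p (scalar_product (\<alpha> v* matrix_power A j) x) \<partial>measure_pmf \<mu>))"
proof -
  interpret prob_space M by fact
  have b: "b i \<in> measurable M (count_space UNIV)" for i
    using indep unfolding indep_vars_def by blast
  define g where "g i x = mod_char p (scalar_product (\<alpha> v* matrix_power A (n - Suc i)) x)" for i x
  have gm: "g i \<in> borel_measurable (count_space UNIV)" for i by simp
  have "indep_vars (\<lambda>_. borel) (\<lambda>i \<omega>. g i (b i \<omega>)) {..<n}"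
    by (rule indep_vars_compose2[OF indep_vars_subset[OF indep]]) (auto intro: gm)
  moreover have int: "integrable M (\<lambda>\<omega>. g i (b i \<omega>))" for i
    by (rule integrable_const_bound[where B = 1])
       (auto simp: g_def intro: measurable_compose[OF b gm, unfolded g_def])
  ultimately have prod: "(\<integral>\<omega>. (\<Prod>i<n. g i (b i \<omega>)) \<partial>M) = (\<Prod>i<n. \<integral>\<omega>. g i (b i \<omega>) \<partial>M)"
    by (intro indep_vars_lebesgue_integral) auto
  have single: "(\<integral>\<omega>. g i (b i \<omega>) \<partial>M) = (\<integral>x. g i x \<partial>measure_pmf \<mu>)" for i
    unfolding law[of i, symmetric] by (rule integral_distr[OF b gm, symmetric])
  have reindex: "(\<Prod>j<n. mod_char p (scalar_product (\<alpha> v* matrix_power A j) (b (n - Suc j) \<omega>))) =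
      (\<Prod>i<n. g i (b i \<omega>))" for \<omega>
  proof -
    have "n - Suc (n - Suc j) = j" if "j < n" for j using that by arith
    then have "(\<Prod>j<n. mod_char p (scalar_product (\<alpha> v* matrix_power A j) (b (n - Suc j) \<omega>))) =
        (\<Prod>j<n. g (n - Suc j) (b (n - Suc j) \<omega>))"
      by (intro prod.cong) (simp_all add: g_def)
    also have "\<dots> = (\<Prod>i<n. g i (b i \<omega>))" by (rule prod.nat_diff_reindex)
    finally show ?thesis .
  qed
  have "(\<integral>x. mod_char p (scalar_product \<alpha> x) \<partial>walk_law M A b x0 p n) =
      (\<integral>\<omega>. mod_char p (scalar_product \<alpha> (walk A b x0 p n \<omega>)) \<partial>M)"
    unfolding walk_law_def by (rule integral_distr[OF measurable_walk[OF p b]]) simp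
  also have "\<dots> = (\<integral>\<omega>. mod_char p (scalar_product (\<alpha> v* matrix_power A n) x0) * (\<Prod>i<n. g i (b i \<omega>)) \<partial>M)"
    by (simp only: mod_char_walk[OF p] reindex)
  also have "\<dots> = mod_char p (scalar_product (\<alpha> v* matrix_power A n) x0) * (\<Prod>i<n. \<integral>x. g i x \<partial>measure_pmf \<mu>)"
    by (simp add: prod single)
  finally have "cmod (\<integral>x. mod_char p (scalar_product \<alpha> x) \<partial>walk_law M A b x0 p n) =
      (\<Prod>i<n. cmod (\<integral>x. g i x \<partial>measure_pmf \<mu>))"
    by (simp add: norm_mult prod_norm)
  also have "\<dots> = (\<Prod>j<n. cmod (\<integral>x. mod_char p (scalar_product (\<alpha> v* matrix_power A j) x) \<partial>measure_pmf \<mu>))"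
    unfolding g_def
    by (rule prod.nat_diff_reindex[of "\<lambda>j. cmod (\<integral>x. mod_char p (scalar_product (\<alpha> v* matrix_power A j) x) \<partial>measure_pmf \<mu>)"])
  finally show ?thesis .
qed

lemma norm_one_plus_cis: "cmod (1 + cis t) = 2 * \<bar>cos (t / 2)\<bar>"
proof -
  have "1 + cis t = cis (t / 2) * (cis (- (t / 2)) + cis (t / 2))"
    by (simp add: distrib_left cis_mult)
  also have "cis (- (t / 2)) + cis (t / 2) = of_real (2 * cos (t / 2))"
    by (simp add: complex_eq_iff)
  finally show ?thesis by (simp add: norm_mult)
qed

lemma exists_centered_residue:
  assumes "p > 0"
  shows "\<exists>w. int p dvd s - w \<and> 2 * \<bar>w\<bar> \<le> int p"
proof (cases "2 * (s mod int p) \<le> int p")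
  case True
  then show ?thesis using assms by (intro exI[of _ "s mod int p"]) (simp add: dvd_minus_mod)
next
  case False
  have "int p dvd (s - s mod int p) + int p" by (intro dvd_add dvd_minus_mod) simp
  moreover have "s mod int p < int p" using assms by simp
  ultimately show ?thesis using False
    by (intro exI[of _ "s mod int p - int p"]) (simp add: algebra_simps)
qed

lemma norm_one_plus_mod_char_le:
  assumes p: "p > 0" and \<delta>: "0 \<le> \<delta>" and far: "\<not> near_multiple \<delta> p s"
  shows "cmod (1 + mod_char p s) \<le> 2 * cos (pi * \<delta>)"
proof -
  obtain w where w: "int p dvd s - w" "2 * \<bar>w\<bar> \<le> int p"
    using exists_centered_residue[OF p] by blast
  define x where "x = \<bar>real_of_int w\<bar> / real p"
  have "\<delta> * real p \<le> \<bar>real_of_int w\<bar>" using far w(1) unfolding near_multiple_def by force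
  then have x1: "\<delta> \<le> x" using p by (simp add: x_def field_simps)
  have "2 * \<bar>real_of_int w\<bar> \<le> real p" using w(2) by linarith
  then have x2: "x \<le> 1 / 2" using p by (simp add: x_def field_simps)
  have "cmod (1 + mod_char p s) = 2 * \<bar>cos (pi * (real_of_int w / real p))\<bar>"
    unfolding mod_char_cong[OF p w(1)] unfolding mod_char_def norm_one_plus_cis by simp
  also have "cos (pi * (real_of_int w / real p)) = cos (pi * x)"
    by (cases "w \<ge> 0") (simp_all add: x_def)
  also have "\<bar>cos (pi * x)\<bar> = cos (pi * x)"
    using x1 x2 \<delta> by (intro abs_of_nonneg cos_ge_zero) (auto simp: field_simps intro: order_trans[of _ 0])
  also have "\<dots> \<le> cos (pi * \<delta>)"
    using x1 x2 \<delta> by (intro cos_monotone_0_pi_le) auto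
  finally show ?thesis by simp
qed

text \<open>The mass \<open>m\<close> common to \<open>h\<close> and \<open>k\<close> carries the two phases at \<open>h\<close> and \<open>k\<close>, whose sum has modulus
  at most \<open>2 cos (\<pi> \<delta>)\<close> instead of 2; the remaining mass is estimated trivially.\<close>

lemma norm_char_pmf_le:
  fixes \<mu> :: "(int ^ 'n) pmf"
  assumes p: "p > 0" and \<delta>: "0 \<le> \<delta>"
    and far: "\<not> near_multiple \<delta> p (scalar_product \<beta> (h - k))"
  shows "cmod (\<integral>x. mod_char p (scalar_product \<beta> x) \<partial>measure_pmf \<mu>) \<le>
    1 - min (pmf \<mu> h) (pmf \<mu> k) * (2 - 2 * cos (pi * \<delta>))"
proof (cases "h = k")
  case True
  \<comment> \<open>here \<open>\<beta> (h - k) = 0\<close>, which can only be far from the multiples of \<open>p\<close> if \<open>\<delta> = 0\<close>\<close>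
  have "cmod (1 + mod_char p 0) \<le> 2 * cos (pi * \<delta>)"
    by (rule norm_one_plus_mod_char_le[OF p \<delta>]) (use far True in simp)
  then have "cos (pi * \<delta>) = 1" using cos_le_one[of "pi * \<delta>"] by simp
  moreover have "cmod (\<integral>x. mod_char p (scalar_product \<beta> x) \<partial>measure_pmf \<mu>) \<le> 
      (\<integral>x. cmod (mod_char p (scalar_product \<beta> x)) \<partial>measure_pmf \<mu>)"
    by (rule integral_norm_bound)
  ultimately show ?thesis by simp
next
  case False
  define f where "f x = mod_char p (scalar_product \<beta> x)" for x
  define m where "m = min (pmf \<mu> h) (pmf \<mu> k)"
  have m: "0 \<le> m" "m \<le> pmf \<mu> h" "m \<le> pmf \<mu> k" by (auto simp: m_def)
  have nf: "cmod (f x) = 1" for x by (simp add: f_def)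
  let ?H = "{h, k}"
  have int: "integrable (measure_pmf \<mu>) g" if "\<And>x. cmod (g x) \<le> 1" for g
    by (rule measure_pmf.integrable_const_bound[where B = 1]) (use that in auto)
  have "(\<integral>x. f x \<partial>measure_pmf \<mu>) =
      (\<integral>x. indicator ?H x *\<^sub>R f x + indicator (- ?H) x *\<^sub>R f x \<partial>measure_pmf \<mu>)"
    by (intro Bochner_Integration.integral_cong) (auto simp: indicator_def)
  also have "\<dots> = (\<integral>x. indicator ?H x *\<^sub>R f x \<partial>measure_pmf \<mu>) + (\<integral>x. indicator (- ?H) x *\<^sub>R f x \<partial>measure_pmf \<mu>)"
    by (intro Bochner_Integration.integral_add int) (auto simp: nf indicator_def)
  also have "(\<integral>x. indicator ?H x *\<^sub>R f x \<partial>measure_pmf \<mu>) = (\<Sum>x\<in>?H. pmf \<mu> x *\<^sub>R (indicator ?H x *\<^sub>R f x))"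
    by (rule integral_measure_pmf) (auto simp: indicator_def split: if_splits)
  also have "\<dots> = pmf \<mu> h *\<^sub>R f h + pmf \<mu> k *\<^sub>R f k" using False by simp
  finally have "cmod (\<integral>x. f x \<partial>measure_pmf \<mu>) \<le>
      cmod (pmf \<mu> h *\<^sub>R f h + pmf \<mu> k *\<^sub>R f k) + cmod (\<integral>x. indicator (- ?H) x *\<^sub>R f x \<partial>measure_pmf \<mu>)"
    by (simp only: norm_triangle_ineq)
  also have "cmod (\<integral>x. indicator (- ?H) x *\<^sub>R f x \<partial>measure_pmf \<mu>) \<le> 1 - pmf \<mu> h - pmf \<mu> k"
  proof -
    have "cmod (\<integral>x. indicator (- ?H) x *\<^sub>R f x \<partial>measure_pmf \<mu>) \<le>
        (\<integral>x. cmod (indicator (- ?H) x *\<^sub>R f x) \<partial>measure_pmf \<mu>)"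
      by (rule integral_norm_bound)
    also have "\<dots> = measure (measure_pmf \<mu>) (- ?H)" by (simp add: nf)
    also have "\<dots> = 1 - measure (measure_pmf \<mu>) ?H"
      using measure_pmf.prob_compl[of ?H \<mu>] by (simp add: Compl_eq_Diff_UNIV)
    also have "measure (measure_pmf \<mu>) ?H = pmf \<mu> h + pmf \<mu> k"
      using False by (simp add: measure_measure_pmf_finite)
    finally show ?thesis by simp
  qed
  also have "cmod (pmf \<mu> h *\<^sub>R f h + pmf \<mu> k *\<^sub>R f k) \<le> (pmf \<mu> h - m) + (pmf \<mu> k - m) + m * (2 * cos (pi * \<delta>))"
  proof -
    have "pmf \<mu> h *\<^sub>R f h + pmf \<mu> k *\<^sub>R f k =
        ((pmf \<mu> h - m) *\<^sub>R f h + (pmf \<mu> k - m) *\<^sub>R f k) + m *\<^sub>R (f h + f k)"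
      by (simp add: algebra_simps)
    also have "cmod \<dots> \<le> (pmf \<mu> h - m) + (pmf \<mu> k - m) + m * cmod (f h + f k)"
      by (intro norm_triangle_le add_mono) (use m in \<open>simp_all add: nf\<close>)
    also have "f h + f k = f k * (1 + mod_char p (scalar_product \<beta> (h - k)))"
      by (simp add: f_def distrib_left scalar_product_diff_right flip: mod_char_add)
    also have "cmod \<dots> = cmod (1 + mod_char p (scalar_product \<beta> (h - k)))"
      by (simp add: norm_mult nf)
    also have "m * \<dots> \<le> m * (2 * cos (pi * \<delta>))"
      by (intro mult_left_mono norm_one_plus_mod_char_le p \<delta> far m)
    finally show ?thesis by simp
  qed
  finally have "cmod (\<integral>x. f x \<partial>measure_pmf \<mu>) \<le> 1 - m * (2 - 2 * cos (pi * \<delta>))"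
    by (simp add: algebra_simps)
  then show ?thesis by (simp add: f_def m_def)
qed

text \<open>The product is cut into \<open>n div H\<close> full blocks, each of which contains a small factor.\<close>

lemma prod_le_power_of_windows:
  fixes f :: "nat \<Rightarrow> real"
  assumes f: "\<And>j. 0 \<le> f j" "\<And>j. f j \<le> 1" and \<rho>: "0 \<le> \<rho>"
    and window: "\<And>s. \<exists>j<H. f (s + j) \<le> \<rho>"
  shows "(\<Prod>j<n. f j) \<le> \<rho> ^ (n div H)"
proof -
  \<comment> \<open>one factor of the block is at most \<open>\<rho>\<close>, the others are at most 1\<close>
  have block: "(\<Prod>j\<in>{q * H..<q * H + H}. f j) \<le> \<rho>" for q
  proof -
    obtain j where j: "j < H" "f (q * H + j) \<le> \<rho>" using window by blast
    have "(\<Prod>i\<in>{q * H..<q * H + H}. f i) =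
        f (q * H + j) * (\<Prod>i\<in>{q * H..<q * H + H} - {q * H + j}. f i)"
      by (rule prod.remove) (use j in auto)
    also have "\<dots> \<le> \<rho> * 1"
      by (intro mult_mono j prod_le_1 prod_nonneg) (use f \<rho> in auto)
    finally show ?thesis by simp
  qed
  have "(\<Prod>j<n div H * H. f j) = (\<Prod>q<n div H. \<Prod>j\<in>{q * H..<q * H + H}. f j)"
    by (rule prod.nat_group[symmetric])
  also have "\<dots> \<le> (\<Prod>q<n div H. \<rho>)"
    by (intro prod_mono conjI block prod_nonneg f)
  finally have blocks: "(\<Prod>j<n div H * H. f j) \<le> \<rho> ^ (n div H)" by simp
  have "(\<Prod>j<n. f j) = (\<Prod>j<n div H * H. f j) * (\<Prod>j\<in>{n div H * H..<n}. f j)"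
    using prod.atLeastLessThan_concat[of 0 "n div H * H" n f] by (simp add: lessThan_atLeast0)
  also have "\<dots> \<le> (\<Prod>j<n div H * H. f j) * 1"
    by (intro mult_left_mono prod_le_1 prod_nonneg) (use f in auto)
  finally show ?thesis using blocks by simp
qed

section \<open>Rate of convergence\<close>

text \<open>The columns of \<open>B\<close> are \<open>A\<^sup>m (h - k)\<close> with \<open>m\<close> in a finite set. Hence an entry of \<open>\<alpha> A\<^sup>j B\<close> far
  from the multiples of \<open>p\<close> yields a frequency \<open>\<alpha> A\<^sup>j\<^sup>+\<^sup>m\<close> at which the transform of \<open>\<mu>\<close> is
  bounded away from 1, at the cost of lengthening the window by the largest \<open>m\<close>.\<close>

lemma logarithmic_window_gap:
  fixes A B :: "int ^ 'n ^ 'n" and \<mu> :: "(int ^ 'n) pmf"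
  assumes eig: "\<And>l. eigenvalue (map_matrix complex_of_int A) l \<Longrightarrow> cmod l \<noteq> 1"
    and B: "columns B \<subseteq> diff_orbit A (set_pmf \<mu>)"
  shows "\<exists>\<kappa> C. 0 < \<kappa> \<and> 0 < C \<and> (\<forall>p\<ge>2. coprime (det A) (int p) \<longrightarrow> coprime (det B) (int p) \<longrightarrow>
    (\<exists>H>0. real H \<le> C * ln (real p) \<and> (\<forall>\<alpha>. \<not> (\<forall>i. int p dvd \<alpha> $ i) \<longrightarrow>
      (\<exists>j<H. cmod (\<integral>x. mod_char p (scalar_product (\<alpha> v* matrix_power A j) x) \<partial>measure_pmf \<mu>) \<le> exp (- \<kappa>)))))"
proof -
  obtain \<delta> L where \<delta>: "0 < \<delta>" "\<delta> \<le> 1" and escape: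
    "\<And>p t \<alpha>. coprime (det A) (int p) \<Longrightarrow> coprime (det B) (int p) \<Longrightarrow> p \<le> 2 ^ t \<Longrightarrow>
      \<not> (\<forall>i. int p dvd \<alpha> $ i) \<Longrightarrow>
      \<exists>j\<le>2 * L * t. \<exists>i. \<not> near_multiple \<delta> p ((\<alpha> v* matrix_power A j v* B) $ i)"
    using dual_orbit_escapes[of A B, OF eig] by blast
  have "\<forall>i. \<exists>m h k. column i B = matrix_power A m *v (h - k) \<and> h \<in> set_pmf \<mu> \<and> k \<in> set_pmf \<mu>"
  proof
    fix i
    have "column i B \<in> diff_orbit A (set_pmf \<mu>)" using B by (auto simp: columns_def)
    then show "\<exists>m h k. column i B = matrix_power A m *v (h - k) \<and> h \<in> set_pmf \<mu> \<and> k \<in> set_pmf \<mu>"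
      unfolding diff_orbit_def by blast
  qed
  then obtain m h k where col: "\<And>i. column i B = matrix_power A (m i) *v (h i - k i)"
    and hk: "\<And>i. h i \<in> set_pmf \<mu>" "\<And>i. k i \<in> set_pmf \<mu>" by metis
  define gap where "gap i = min (pmf \<mu> (h i)) (pmf \<mu> (k i)) * (2 - 2 * cos (pi * \<delta>))" for i
  define \<kappa> where "\<kappa> = Min (range gap)"
  define D where "D = Max (range m)"
  define C where "C = (4 * real L + real D + 1) / ln 2"
  have "cos (pi * \<delta>) < cos 0" by (rule cos_monotone_0_pi) (use \<delta> in auto)
  then have "gap i > 0" for i
    unfolding gap_def using hk by (intro mult_pos_pos) (auto simp: pmf_positive)
  then have \<kappa>: "\<kappa> > 0" unfolding \<kappa>_def by (subst Min_gr_iff) auto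
  have C: "C > 0" unfolding C_def by (intro divide_pos_pos) auto
  show ?thesis
  proof (rule exI[of _ \<kappa>], rule exI[of _ C], intro conjI allI impI \<kappa> C)
    fix p :: nat
    assume p2: "p \<ge> 2" and cop: "coprime (det A) (int p)" "coprime (det B) (int p)"
    \<comment> \<open>the least exponent with \<open>p \<le> 2 ^ t\<close>; it is at most \<open>2 * log 2 p\<close> because \<open>p \<ge> 2\<close>\<close>
    define t where "t = nat \<lceil>log 2 (real p)\<rceil>"
    have log1: "log 2 (real p) \<ge> 1" using p2 by (simp add: le_log_iff)
    have "log 2 (real p) \<le> real t" unfolding t_def by (rule real_nat_ceiling_ge)
    then have "real p \<le> 2 powr real t" using p2 by (simp add: log_le_iff)
    then have "real p \<le> real (2 ^ t)" by (simp add: powr_realpow)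
    then have pt: "p \<le> 2 ^ t" by (simp only: of_nat_le_iff)
    have t: "real t \<le> 2 * log 2 (real p)"
      unfolding t_def using log1 by linarith
    define H where "H = 2 * L * t + D + 1"
    have "real H = 2 * real L * real t + (real D + 1) * 1" by (simp add: H_def)
    also have "\<dots> \<le> 2 * real L * (2 * log 2 (real p)) + (real D + 1) * log 2 (real p)"
      by (intro add_mono mult_left_mono t log1) auto
    also have "\<dots> = C * ln (real p)" by (simp add: C_def log_def field_simps)
    finally have H: "real H \<le> C * ln (real p)" .
    show "\<exists>H>0. real H \<le> C * ln (real p) \<and> (\<forall>\<alpha>. \<not> (\<forall>i. int p dvd \<alpha> $ i) \<longrightarrow>
      (\<exists>j<H. cmod (\<integral>x. mod_char p (scalar_product (\<alpha> v* matrix_power A j) x) \<partial>measure_pmf \<mu>) \<le> exp (- \<kappa>)))"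
    proof (rule exI[of _ H], intro conjI allI impI H)
      show "H > 0" by (simp add: H_def)
      fix \<alpha> :: "int ^ 'n" assume "\<not> (\<forall>i. int p dvd \<alpha> $ i)"
      then obtain j i where j: "j \<le> 2 * L * t"
        and far: "\<not> near_multiple \<delta> p ((\<alpha> v* matrix_power A j v* B) $ i)"
        using escape[OF cop pt] by blast
      let ?\<beta> = "\<alpha> v* matrix_power A (j + m i)"
      \<comment> \<open>an entry of \<open>\<alpha> A\<^sup>j B\<close> is the pairing of \<open>\<alpha> A\<^sup>j\<^sup>+\<^sup>m\<close> with a difference of support points\<close>
      have "(\<alpha> v* matrix_power A j v* B) $ i = scalar_product (\<alpha> v* matrix_power A j) (column i B)"
        by (simp add: vector_matrix_mult_def scalar_product_def column_def mult.commute)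
      also have "\<dots> = scalar_product ?\<beta> (h i - k i)"
        by (simp only: col scalar_product_matrix[symmetric] vector_matrix_mul_assoc matrix_power_add)
      finally have "\<not> near_multiple \<delta> p (scalar_product ?\<beta> (h i - k i))" using far by simp
      then have "cmod (\<integral>x. mod_char p (scalar_product ?\<beta> x) \<partial>measure_pmf \<mu>) \<le> 1 - gap i"
        unfolding gap_def using p2 \<delta> by (intro norm_char_pmf_le) auto
      also have "\<dots> \<le> 1 - \<kappa>" by (simp add: \<kappa>_def)
      also have "\<dots> \<le> exp (- \<kappa>)" using exp_ge_add_one_self[of "- \<kappa>"] by simp
      finally have "cmod (\<integral>x. mod_char p (scalar_product ?\<beta> x) \<partial>measure_pmf \<mu>) \<le> exp (- \<kappa>)" .
      moreover have "m i \<le> D" by (simp add: D_def)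
      then have "j + m i < H" using j by (simp add: H_def)
      ultimately show "\<exists>j<H. cmod (\<integral>x. mod_char p (scalar_product (\<alpha> v* matrix_power A j) x) \<partial>measure_pmf \<mu>) \<le> exp (- \<kappa>)"
        by blast
    qed
  qed
qed

lemma Z_mod_nonzero_residue:
  assumes "\<alpha> \<in> Z_mod p - {0}"
  shows "\<not> (\<forall>i. int p dvd \<alpha> $ i)"
proof
  assume d: "\<forall>i. int p dvd \<alpha> $ i"
  have "\<alpha> $ i = 0" for i
  proof -
    have "\<alpha> $ i mod int p = \<alpha> $ i" using assms by (simp add: Z_mod_def)
    moreover have "\<alpha> $ i mod int p = 0" using d by simp
    ultimately show ?thesis by simp
  qed
  then show False using assms by (simp add: vec_eq_iff)
qed

text \<open>With windows of length at most \<open>C ln p\<close> there are at least \<open>n / (C ln p) - 1\<close> of them, and each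
  contributes \<open>exp (- \<kappa>)\<close>. The constant in front of \<open>(ln p)\<^sup>2\<close> makes this beat the
  \<open>p\<^sup>k\<close> frequencies with one power of \<open>p\<close> to spare.\<close>

lemma exp_power_window_bound:
  fixes \<kappa> C :: real and H n k p :: nat
  assumes \<kappa>: "\<kappa> > 0" and C: "C > 0" and H: "H > 0" "real H \<le> C * ln (real p)" and p: "p \<ge> 2"
    and n: "real n \<ge> C * (real k + 1) / \<kappa> * (ln (real p))\<^sup>2"
  shows "real (p ^ k) * exp (- \<kappa>) ^ (n div H) \<le> exp \<kappa> / real p"
proof -
  have lnp: "ln (real p) > 0" using p by simp
  have "(real k + 1) / \<kappa> * ln (real p) = C * (real k + 1) / \<kappa> * (ln (real p))\<^sup>2 / (C * ln (real p))"
    using C lnp by (simp add: power2_eq_square)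
  also have "\<dots> \<le> real n / (C * ln (real p))"
    using n C lnp by (intro divide_right_mono) auto
  also have "\<dots> \<le> real n / real H" using H by (intro divide_left_mono) auto
  also have "\<dots> \<le> real (n div H) + 1" 
  proof -
    have "n \<le> (n div H + 1) * H"
      unfolding distrib_right using div_mult_mod_eq[of n H] mod_less_divisor[OF H(1), of n] by linarith
    then have "real n \<le> real ((n div H + 1) * H)" by (simp only: of_nat_le_iff)
    also have "\<dots> = (real (n div H) + 1) * real H" by (simp only: of_nat_mult of_nat_add of_nat_1)
    finally show ?thesis using H(1) by (simp add: pos_divide_le_eq)
  qed
  finally have "\<kappa> * ((real k + 1) / \<kappa> * ln (real p)) \<le> \<kappa> * (real (n div H) + 1)"
    using \<kappa> by (intro mult_left_mono) auto
  moreover have "\<kappa> * ((real k + 1) / \<kappa> * ln (real p)) = (real k + 1) * ln (real p)" using \<kappa> by simp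
  ultimately have *: "real k * ln (real p) + - \<kappa> * real (n div H) \<le> \<kappa> - ln (real p)"
    by (simp add: algebra_simps)
  have "real (p ^ k) * exp (- \<kappa>) ^ (n div H) = exp (real k * ln (real p) + - \<kappa> * real (n div H))"
    using p by (simp only: exp_add exp_of_nat_mult exp_of_nat2_mult of_nat_power) simp
  also have "\<dots> \<le> exp (\<kappa> - ln (real p))" using * by simp
  also have "\<dots> = exp \<kappa> / real p" using p by (simp add: exp_diff)
  finally show ?thesis .
qed

theorem theorem3p1:
  fixes A B :: "int ^ 'k::finite ^ 'k"
    and \<mu> :: "(int ^ 'k) pmf"
    and M :: "'w measure"
    and b :: "nat \<Rightarrow> 'w \<Rightarrow> int ^ 'k"
    and x0 :: "int ^ 'k"
  assumes "invertible (rat_matrix A)"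
    and "\<And>l. eigenvalue (map_matrix complex_of_int A) l \<Longrightarrow> cmod l \<noteq> 1"
    and "\<not> (\<exists>W. vec.subspace W \<and> W \<noteq> UNIV \<and> invariant_under (rat_matrix A) W \<and>
               parallel_to (set_pmf \<mu>) W)"
    and "prob_space M"
    and "prob_space.indep_vars M (\<lambda>_. count_space UNIV) b UNIV"
    and "\<And>n. distr M (count_space UNIV) (b n) = measure_pmf \<mu>"
    and "is_column_basis B"
    and "columns B \<subseteq> diff_orbit A (set_pmf \<mu>)"
  shows "\<exists>(c::real) (\<epsilon>::nat \<Rightarrow> real). c > 0 \<and> \<epsilon> \<longlonglongrightarrow> 0 \<and>
           (\<forall>p n. p > 0 \<and> gcd (det A) (int p) = 1 \<and> gcd (det B) (int p) = 1 \<and>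
                  real n \<ge> c * (ln (real p))\<^sup>2 \<longrightarrow>
              variation_distance (Z_mod p) (walk_law M A b x0 p n)
                (uniform_count_measure (Z_mod p)) \<le> \<epsilon> p)"
proof -
  obtain \<kappa> C where \<kappa>: "\<kappa> > 0" and C: "C > 0" and gap:
    "\<And>p. p \<ge> 2 \<Longrightarrow> coprime (det A) (int p) \<Longrightarrow> coprime (det B) (int p) \<Longrightarrow>
    \<exists>H>0. real H \<le> C * ln (real p) \<and> (\<forall>\<alpha>. \<not> (\<forall>i. int p dvd \<alpha> $ i) \<longrightarrow>
      (\<exists>j<H. cmod (\<integral>x. mod_char p (scalar_product (\<alpha> v* matrix_power A j) x) \<partial>measure_pmf \<mu>) \<le> exp (- \<kappa>)))"
    using logarithmic_window_gap[of A B \<mu>, OF assms(2) assms(8)] by blast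
  define c where "c = C * (real CARD('k) + 1) / \<kappa>"
  define \<epsilon> where "\<epsilon> p = exp \<kappa> / real p" for p
  have c: "c > 0" using C \<kappa> by (simp add: c_def)
  have \<epsilon>: "\<epsilon> \<longlonglongrightarrow> 0" unfolding \<epsilon>_def by (rule lim_const_over_n)
  have bound: "variation_distance (Z_mod p) (walk_law M A b x0 p n) (uniform_count_measure (Z_mod p)) \<le> \<epsilon> p"
    if p: "p > 0" and cop: "coprime (det A) (int p)" "coprime (det B) (int p)"
      and n: "real n \<ge> c * (ln (real p))\<^sup>2" for p n
  proof -
    have b: "b i \<in> measurable M (count_space UNIV)" for i
      using assms(5) unfolding prob_space.indep_vars_def[OF assms(4)] by blast
    have "prob_space (walk_law M A b x0 p n)"
      unfolding walk_law_def by (rule prob_space.prob_space_distr[OF assms(4) measurable_walk[OF p b]])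
    then have "variation_distance (Z_mod p) (walk_law M A b x0 p n) (uniform_count_measure (Z_mod p)) \<le>
        (\<Sum>\<alpha>\<in>Z_mod p - {0}. cmod (\<integral>x. mod_char p (scalar_product \<alpha> x) \<partial>walk_law M A b x0 p n))"
      by (rule variation_distance_uniform_le_sum_char[OF p]) (simp add: walk_law_def)
    also have "\<dots> \<le> \<epsilon> p"
    proof (cases "p = 1")
      case True
      \<comment> \<open>for \<open>p = 1\<close> there is no nonzero frequency; the bound \<open>ln p > 0\<close> of the other case fails\<close>
      have empty: "Z_mod p - {0 :: int ^ 'k} = {}"
        using Z_mod_nonzero_residue[where p = p and 'a = 'k] True by auto
      show ?thesis unfolding empty by (simp add: \<epsilon>_def)
    next
      case False
      then have p2: "p \<ge> 2" using p by simp
      define F where "F \<alpha> = cmod (\<integral>x. mod_char p (scalar_product \<alpha> x) \<partial>measure_pmf \<mu>)" for \<alpha>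
      obtain H where H: "H > 0" "real H \<le> C * ln (real p)" and window:
        "\<And>\<alpha>. \<not> (\<forall>i. int p dvd \<alpha> $ i) \<Longrightarrow> \<exists>j<H. F (\<alpha> v* matrix_power A j) \<le> exp (- \<kappa>)"
        unfolding F_def using gap[OF p2 cop] by blast
      have "F \<alpha> \<le> (\<integral>x. cmod (mod_char p (scalar_product \<alpha> x)) \<partial>measure_pmf \<mu>)" for \<alpha>
        unfolding F_def by (rule integral_norm_bound)
      then have F1: "F \<alpha> \<le> 1" for \<alpha> by simp
      have "cmod (\<integral>x. mod_char p (scalar_product \<alpha> x) \<partial>walk_law M A b x0 p n) \<le> exp (- \<kappa>) ^ (n div H)"
        if \<alpha>: "\<alpha> \<in> Z_mod p - {0}" for \<alpha>
      proof -
        have "cmod (\<integral>x. mod_char p (scalar_product \<alpha> x) \<partial>walk_law M A b x0 p n) =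
            (\<Prod>j<n. F (\<alpha> v* matrix_power A j))"
          unfolding F_def by (rule norm_char_walk_law[OF assms(4) p assms(5,6)])
        also have "\<dots> \<le> exp (- \<kappa>) ^ (n div H)"
        proof (rule prod_le_power_of_windows)
          fix s
          have "\<not> (\<forall>i. int p dvd (\<alpha> v* matrix_power A s) $ i)"
            using coprime_det_dvd_cancel_power[OF cop(1)] Z_mod_nonzero_residue[OF \<alpha>] by blast
          from window[OF this] show "\<exists>j<H. F (\<alpha> v* matrix_power A (s + j)) \<le> exp (- \<kappa>)"
            by (simp add: vector_matrix_mul_assoc matrix_power_add)
        qed (simp_all add: F1, simp add: F_def)
        finally show ?thesis .
      qed
      then have "(\<Sum>\<alpha>\<in>Z_mod p - {0}. cmod (\<integral>x. mod_char p (scalar_product \<alpha> x) \<partial>walk_law M A b x0 p n))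
          \<le> (\<Sum>\<alpha>\<in>Z_mod p - {0 :: int ^ 'k}. exp (- \<kappa>) ^ (n div H))"
        by (intro sum_mono)
      also have "\<dots> \<le> (\<Sum>\<alpha>\<in>(Z_mod p :: (int ^ 'k) set). exp (- \<kappa>) ^ (n div H))"
        by (intro sum_mono2) auto
      also have "\<dots> = real (p ^ CARD('k)) * exp (- \<kappa>) ^ (n div H)"
        by (simp add: card_Z_mod)
      also have "\<dots> \<le> \<epsilon> p"
        unfolding \<epsilon>_def using n by (intro exp_power_window_bound[OF \<kappa> C H p2]) (simp add: c_def)
      finally show ?thesis .
    qed
    finally show ?thesis .
  qed
  show ?thesis
    by (rule exI[of _ c], rule exI[of _ \<epsilon>]) (use c \<epsilon> bound in \<open>auto simp: coprime_iff_gcd_eq_1\<close>)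
qed

end
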